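(* Let $f,g$ satisfy $(H_1)$, $(H_2)$, $(H_3)$ and let $K$ be a kernel as in the context. Suppose that for any $c\in\mathbb{R}$ there exists some $\gamma^\#=\gamma^\#(c)\in(0,+\infty]$ such that $\chi_0(z,c)<\infty$ for each $z\in[0,\gamma^\#)$ and $\chi_0(z,c)$ diverges if $z>\gamma^\#$. Suppose also that, for some $L>0$, $|g(s_1)-g(s_2)|\le L|s_1-s_2|$ for all $s_1,s_2\ge 0$. Then for any $c<c_*$ the equation $$u_t(t,x)=u_{xx}(t,x)-f(u(t,x))+\int_0^\infty\int_{\mathbb{R}}K(s,w)g(u(t-s,x-w))\,dw\,ds$$ has no semi-wavefront solution $u(t,x)=\phi(x+ct)$ propagating with speed $c$.
   Context: Kernel: $K\in L^1(\mathbb{R}_+\times\mathbb{R})$, $K\ge0$, $\int_0^\infty\int_{\mathbb{R}}K(s,w)\,dw\,ds=1$ ($K$ may be asymmetric in $w$). Hypotheses: $(H_1)$ $g\in C(\mathbb{R}_+,\mathbb{R}_+)$, $g(0)=0$, $g(s)>0$ for all $s>0$, $g$ is differentiable at $0$ with $g'(0)>0$. $(H_2)$ $f\in C^1(\mathbb{R}_+,\mathbb{R}_+)$, $f(0)=0$, $f$ is strictly increasing, and $f'(0)<g'(0)$. $(H_3)$ $f,g\in C^{1,\alpha}$ in some neighborhood of $0$ (in $\mathbb{R}_+$), for some $\alpha\in(0,1)$. A semi-wavefront with speed $c$ is a solution $u(t,x)=\phi(x+ct)$ whose profile $\phi:\mathbb{R}\to(0,\infty)$ is bounded, continuous, non-constant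 and satisfies $\phi(-\infty)=0$; equivalently, $\phi$ is a positive bounded non-constant solution on $\mathbb{R}$ of $\phi''(t)-c\phi'(t)-f(\phi(t))+\int_0^\infty\int_{\mathbb{R}}K(s,w)g(\phi(t-cs-w))\,dw\,ds=0$ with $\phi(-\infty)=0$. Characteristic function (for real $z\ge 0$, $c\in\mathbb{R}$): $$\chi_0(z,c)=z^2-cz-f'(0)+g'(0)\int_0^\infty\int_{\mathbb{R}}K(s,w)e^{-z(cs+w)}\,dw\,ds.$$ $c_*$ is the minimal value of $c$ for which $\chi_0(\cdot,c)$ has at least one positive root. *)

theory Defs
  imports "HOL-Analysis.Analysis"
begin

text \<open>
  The nonlinearities \<open>f\<close> and \<open>g\<close> are total functions on the reals of which only the values on
  \<open>{0..}\<close> matter; derivatives are therefore taken within \<open>{0..}\<close>, so that the one at \<open>0\<close> is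
  the right derivative.
\<close>

definition half_line_deriv :: "(real \<Rightarrow> real) \<Rightarrow> real \<Rightarrow> real" where
  "half_line_deriv h s = vector_derivative h (at s within {0..})"

text \<open>
  The kernel is a representative of a class in \<open>L\<^sup>1\<close> for the two-dimensional Lebesgue measure,
  so nonnegativity is required almost everywhere. Double integrals over \<open>s \<ge> 0\<close> and real \<open>w\<close> are
  integrals over the half-plane, which agree with iterated ones by Fubini and Tonelli.
\<close>

definition half_plane :: "(real \<times> real) set" where
  "half_plane = {0..} \<times> UNIV"

definition normalized_kernel :: "(real \<times> real \<Rightarrow> real) \<Rightarrow> bool" where
  "normalized_kernel K \<longleftrightarrow>
     set_integrable lebesgue half_plane K \<and>
     (AE p in lebesgue. p \<in> half_plane \<longrightarrow> K p \<ge> 0) \<and>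
     set_lebesgue_integral lebesgue half_plane K = 1"

definition H1 :: "(real \<Rightarrow> real) \<Rightarrow> bool" where
  "H1 g \<longleftrightarrow>
     continuous_on {0..} g \<and> (\<forall>s\<ge>0. g s \<ge> 0) \<and> g 0 = 0 \<and> (\<forall>s>0. g s > 0) \<and>
     g differentiable (at 0 within {0..}) \<and> half_line_deriv g 0 > 0"

definition H2 :: "(real \<Rightarrow> real) \<Rightarrow> (real \<Rightarrow> real) \<Rightarrow> bool" where
  "H2 f g \<longleftrightarrow>
     f differentiable_on {0..} \<and> continuous_on {0..} (half_line_deriv f) \<and>
     (\<forall>s\<ge>0. f s \<ge> 0) \<and> f 0 = 0 \<and> strict_mono_on {0..} f \<and>
     half_line_deriv f 0 < half_line_deriv g 0"

definition C1_holder_near_0 :: "real \<Rightarrow> (real \<Rightarrow> real) \<Rightarrow> bool" where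
  "C1_holder_near_0 \<alpha> h \<longleftrightarrow>
     (\<exists>\<delta>>0. (\<forall>s\<in>{0..<\<delta>}. h differentiable (at s within {0..})) \<and>
       (\<exists>C. \<forall>s\<in>{0..<\<delta>}. \<forall>t\<in>{0..<\<delta>}.
          \<bar>half_line_deriv h s - half_line_deriv h t\<bar> \<le> C * \<bar>s - t\<bar> powr \<alpha>))"

definition H3 :: "(real \<Rightarrow> real) \<Rightarrow> (real \<Rightarrow> real) \<Rightarrow> bool" where
  "H3 f g \<longleftrightarrow> (\<exists>\<alpha>. 0 < \<alpha> \<and> \<alpha> < 1 \<and> C1_holder_near_0 \<alpha> f \<and> C1_holder_near_0 \<alpha> g)"

text \<open>
  The characteristic function takes the value \<open>\<infinity>\<close> exactly where its integral diverges
  (for a kernel and \<open>g'(0) > 0\<close>). In particular a zero is a point of convergence.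
\<close>

definition chi0 ::
  "(real \<Rightarrow> real) \<Rightarrow> (real \<Rightarrow> real) \<Rightarrow> (real \<times> real \<Rightarrow> real) \<Rightarrow> real \<Rightarrow> real \<Rightarrow> ereal" where
  "chi0 f g K z c =
     ereal (z\<^sup>2 - c * z - half_line_deriv f 0) +
     ereal (half_line_deriv g 0) *
       enn2ereal (\<integral>\<^sup>+(s, w)\<in>half_plane. ennreal (K (s, w) * exp (- z * (c * s + w))) \<partial>lebesgue)"

definition c_star ::
  "(real \<Rightarrow> real) \<Rightarrow> (real \<Rightarrow> real) \<Rightarrow> (real \<times> real \<Rightarrow> real) \<Rightarrow> real" where
  "c_star f g K = (LEAST c. \<exists>z>0. chi0 f g K z c = 0)"

definition solution ::
  "(real \<Rightarrow> real) \<Rightarrow> (real \<Rightarrow> real) \<Rightarrow> (real \<times> real \<Rightarrow> real) \<Rightarrow> (real \<Rightarrow> real \<Rightarrow> real) \<Rightarrow> bool" where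
  "solution f g K u \<longleftrightarrow>
     (\<forall>t x.
        (\<lambda>\<tau>. u \<tau> x) differentiable (at t) \<and>
        u t differentiable (at x) \<and>
        deriv (u t) differentiable (at x) \<and>
        set_integrable lebesgue half_plane (\<lambda>(s, w). K (s, w) * g (u (t - s) (x - w))) \<and>
        deriv (\<lambda>\<tau>. u \<tau> x) t =
          deriv (deriv (u t)) x - f (u t x) +
          set_lebesgue_integral lebesgue half_plane (\<lambda>(s, w). K (s, w) * g (u (t - s) (x - w))))"

definition semi_wavefront ::
  "(real \<Rightarrow> real) \<Rightarrow> (real \<Rightarrow> real) \<Rightarrow> (real \<times> real \<Rightarrow> real) \<Rightarrow> real \<Rightarrow> (real \<Rightarrow> real) \<Rightarrow> bool" where
  "semi_wavefront f g K c \<phi> \<longleftrightarrow>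
     (\<forall>t. \<phi> t > 0) \<and> bounded (range \<phi>) \<and> continuous_on UNIV \<phi> \<and>
     \<not> \<phi> constant_on UNIV \<and> (\<phi> \<longlongrightarrow> 0) at_bot \<and>
     solution f g K (\<lambda>t x. \<phi> (x + c * t))"

end

theory Submission
  imports Defs "HOL-Probability.Probability_Measure" "HOL-Real_Asymp.Real_Asymp"
begin

text \<open>
  Suppose that a semi-wavefront \<open>\<phi>\<close> with speed \<open>c\<close> exists although \<open>\<chi>\<^sub>0(\<sqdot>, c)\<close> has no positive zero,
  so that it is positive on \<open>{0..}\<close>. By Fatou's lemma positivity on a compact interval survives,
  with a lower bound \<open>\<kappa> > 0\<close>, when the kernel is cut off to \<open>\<bar>c s + w\<bar> \<le> M\<close> and \<open>f'(0)\<close>, \<open>g'(0)\<close> are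
  replaced by \<open>a > f'(0)\<close>, \<open>b < g'(0)\<close>. Since \<open>\<phi>\<close> is small near \<open>-\<infinity>\<close>, a translate \<open>\<psi>\<close> of \<open>\<phi>\<close>
  satisfies \<open>\<psi>'' - c \<psi>' \<le> a \<psi> - b (\<psi> * \<mu>)\<close> on \<open>t \<le> 0\<close>, where \<open>\<mu>\<close> is the law of \<open>c s + w\<close> under
  the cut-off kernel. Let \<open>\<Lambda>\<close> be the positive root of \<open>z\<^sup>2 - c z = a\<close>. Positivity forces
  \<open>\<psi>' \<le> \<Lambda> \<psi>\<close>, whence a one-sided Harnack inequality and \<open>\<psi>(t) \<ge> \<psi>(0) exp(\<Lambda> t)\<close>. Integrating the
  inequality against \<open>exp(- z t)\<close> over \<open>[-N, 0]\<close> bounds \<open>\<kappa>\<close> times the weighted integral by a constant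
  plus a multiple of its derivative in \<open>N\<close>. So that integral is bounded unless it grows at a fixed
  exponential rate, and a bound \<open>\<psi>(t) \<le> A exp(z t)\<close> improves to the exponent \<open>z + \<rho>/2\<close> with \<open>\<rho>\<close>
  independent of \<open>z\<close>. Iterating past \<open>\<Lambda>\<close> contradicts the lower bound.

  The same combination of Fatou's lemma and compactness shows that the minimum defining \<open>c\<^sub>*\<close> is
  attained.
\<close>

subsection \<open>Positive supersolutions of linear convolution inequalities\<close>

locale linear_supersolution = finite_measure \<mu> for \<mu> :: "real measure" +
  fixes \<psi> p q :: "real \<Rightarrow> real" and a b c M \<Lambda> B :: real
  assumes sets_mu [measurable_cong]: "sets \<mu> = sets borel"
    and supp: "AE y in \<mu>. \<bar>y\<bar> \<le> M" and M: "0 \<le> M"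
    and pos: "\<And>t. 0 < \<psi> t" and bound: "\<And>t. \<psi> t \<le> B"
    and deriv1: "\<And>t. (\<psi> has_real_derivative p t) (at t)"
    and deriv2: "\<And>t. (p has_real_derivative q t) (at t)"
    and super: "\<And>t. t \<le> 0 \<Longrightarrow> q t - c * p t \<le> a * \<psi> t - b * (\<integral>y. \<psi> (t - y) \<partial>\<mu>)"
    and a: "0 < a" and b: "0 \<le> b"
    and lam: "0 < \<Lambda>" "\<Lambda>\<^sup>2 - c * \<Lambda> = a"
begin

section \<open>One-sided Harnack inequality\<close>

lemma psi_continuous: "continuous_on A \<psi>"
  using deriv1 by (meson DERIV_continuous_on DERIV_subset subset_UNIV)

lemma psi_measurable [measurable]: "\<psi> \<in> borel_measurable borel"
  using psi_continuous[of UNIV] by (rule borel_measurable_continuous_onI)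

lemma conv_nonneg: "0 \<le> (\<integral>y. \<psi> (t - y) \<partial>\<mu>)"
  using pos by (intro integral_nonneg_AE) (auto intro: less_imp_le)

text \<open>The operator factors as \<open>(D - l) (D - \<Lambda>)\<close> with
  \<open>l < 0\<close>. If \<open>v\<close> were positive at some \<open>t \<le> 0\<close>, it would
  be at least \<open>v t\<close> everywhere to the left, so \<open>\<psi>\<close> would have slope
  at least \<open>v t\<close> there and lose positivity.\<close>

lemma deriv_le: assumes "t \<le> 0" shows "p t \<le> \<Lambda> * \<psi> t"
proof (rule ccontr)
  assume neg: "\<not> ?thesis"
  define v where "v = (\<lambda>t. p t - \<Lambda> * \<psi> t)"
  have v0: "0 < v t" using neg by (simp add: v_def)
  \<comment> \<open>The other root of \<open>z\<^sup>2 - c z - a\<close>: the roots have sum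
    \<open>c\<close> and product \<open>- a\<close>.\<close>
  define l where "l = c - \<Lambda>"
  have "\<Lambda> * l = - a" using lam by (simp add: l_def algebra_simps power2_eq_square)
  then have l: "l < 0" using a lam by (smt (verit) mult_nonneg_nonneg)
  have mono: "v t * exp (- l * t) \<le> v r * exp (- l * r)" if "r \<le> t" for r
  proof (rule DERIV_nonpos_imp_nonincreasing[OF that, where f="\<lambda>r. v r * exp (- l * r)"])
    fix x assume "r \<le> x" "x \<le> t"
    have "((\<lambda>r. v r * exp (- l * r)) has_real_derivative
        (q x - \<Lambda> * p x) * exp (- l * x) + v x * (exp (- l * x) * (- l))) (at x)"
      unfolding v_def by (auto intro!: derivative_eq_intros deriv1 deriv2)
    moreover have "(q x - \<Lambda> * p x) * exp (- l * x) + v x * (exp (- l * x) * (- l))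
        = (q x - c * p x + (\<Lambda> * l) * \<psi> x) * exp (- l * x)"
      by (simp add: v_def l_def algebra_simps)
    moreover have "q x - c * p x + (\<Lambda> * l) * \<psi> x \<le> 0"
      using super[of x] \<open>x \<le> t\<close> assms \<open>\<Lambda> * l = - a\<close> mult_nonneg_nonneg[OF b conv_nonneg[of x]] by auto
    ultimately show "\<exists>y. ((\<lambda>r. v r * exp (- l * r)) has_real_derivative y) (at x) \<and> y \<le> 0"
      by (auto simp: mult_nonpos_nonneg)
  qed
  have pge: "v t \<le> p r" if "r \<le> t" for r
  proof -
    have "v t * exp (- l * r) \<le> v t * exp (- l * t)"
      using v0 l that by (auto intro!: mult_left_mono)
    have "1 \<le> exp (- l * (t - r))" using l that by (auto simp: mult_nonpos_nonneg)
    then have "v t \<le> v t * exp (- l * (t - r))" using v0 by simp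
    also have "\<dots> = v t * exp (- l * t) * exp (l * r)"
      by (simp add: exp_add[symmetric] algebra_simps)
    also have "\<dots> \<le> v r * exp (- l * r) * exp (l * r)" using mono[OF that] by simp
    also have "\<dots> = v r" by (simp add: exp_add[symmetric])
    also have "\<dots> \<le> p r" using lam pos[of r] by (simp add: v_def)
    finally show ?thesis .
  qed
  \<comment> \<open>The zero of the line through \<open>(t, \<psi> t)\<close> with slope
    \<open>v t\<close>, below which \<open>\<psi>\<close> stays to the left of
    \<open>t\<close>.\<close>
  define r where "r = t - \<psi> t / v t"
  have rt: "r \<le> t" using v0 pos[of t] by (simp add: r_def)
  have "\<psi> r - v t * r \<le> \<psi> t - v t * t"
  proof (rule DERIV_nonneg_imp_nondecreasing[OF rt, where f="\<lambda>r. \<psi> r - v t * r"])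
    fix x assume "r \<le> x" "x \<le> t"
    have "((\<lambda>r. \<psi> r - v t * r) has_real_derivative p x - v t) (at x)"
      by (auto intro!: derivative_eq_intros deriv1)
    then show "\<exists>y. ((\<lambda>r. \<psi> r - v t * r) has_real_derivative y) (at x) \<and> 0 \<le> y"
      using pge[OF \<open>x \<le> t\<close>] by auto
  qed
  moreover have "v t * r = v t * t - \<psi> t" using v0 by (simp add: r_def right_diff_distrib)
  ultimately have "\<psi> r \<le> 0" by simp
  with pos[of r] show False by simp
qed

text \<open>By \<open>deriv_le\<close>, \<open>exp (- \<Lambda> t) \<psi>\<close> is nonincreasing
  on the left half-line. So \<open>\<psi>\<close> cannot decay faster than
  \<open>exp (\<Lambda> t)\<close>.\<close>

lemma harnack: assumes "r \<le> t" "t \<le> 0" shows "\<psi> t \<le> exp (\<Lambda> * (t - r)) * \<psi> r"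
proof -
  have "\<psi> t * exp (- \<Lambda> * t) \<le> \<psi> r * exp (- \<Lambda> * r)"
  proof (rule DERIV_nonpos_imp_nonincreasing[OF assms(1), where f="\<lambda>r. \<psi> r * exp (- \<Lambda> * r)"])
    fix x assume "r \<le> x" "x \<le> t"
    have "((\<lambda>r. \<psi> r * exp (- \<Lambda> * r)) has_real_derivative
        (p x - \<Lambda> * \<psi> x) * exp (- \<Lambda> * x)) (at x)"
      by (auto intro!: derivative_eq_intros deriv1 simp: algebra_simps)
    then show "\<exists>y. ((\<lambda>r. \<psi> r * exp (- \<Lambda> * r)) has_real_derivative y) (at x) \<and> y \<le> 0"
      using deriv_le[of x] \<open>x \<le> t\<close> assms by (auto simp: mult_nonpos_nonneg intro!: exI)
  qed
  from mult_right_mono[OF this, of "exp (\<Lambda> * t)"] show ?thesis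
    by (simp add: mult.assoc exp_add[symmetric] algebra_simps)
qed

section \<open>Truncated Laplace integrals\<close>

definition weighted :: "real \<Rightarrow> real \<Rightarrow> real" where
  "weighted z t = exp (- z * t) * \<psi> t"

text \<open>The cut-off at \<open>- N\<close> keeps this finite before any decay of
  \<open>\<psi>\<close> is known; it is studied as a function of \<open>N\<close>.\<close>

definition mass :: "real \<Rightarrow> real \<Rightarrow> real" where
  "mass z N = integral {- N..0} (weighted z)"

definition transform :: "real \<Rightarrow> real" where
  "transform z = (\<integral>y. exp (- z * y) \<partial>\<mu>)"

lemma weighted_pos: "0 < weighted z t" using pos by (simp add: weighted_def)

lemma weighted_continuous: "continuous_on A (weighted z)"
  unfolding weighted_def by (intro continuous_intros psi_continuous)

lemma weighted_int: "weighted z integrable_on {x..y}"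
  by (intro integrable_continuous_interval weighted_continuous)

lemma weighted_integral_nonneg: "0 \<le> integral {x..y} (weighted z)"
  by (intro integral_nonneg weighted_int) (auto intro: less_imp_le weighted_pos)

lemma weighted_integral_mono: "x' \<le> x \<Longrightarrow> y \<le> y' \<Longrightarrow> integral {x..y} (weighted z) \<le> integral {x'..y'} (weighted z)"
  by (intro integral_subset_le weighted_int) (auto intro: less_imp_le weighted_pos)

lemma weighted_harnack:
  assumes "0 \<le> z" "r \<le> t" "t \<le> 0" shows "weighted z t \<le> exp (\<Lambda> * (t - r)) * weighted z r"
proof -
  have "weighted z t \<le> exp (- z * r) * (exp (\<Lambda> * (t - r)) * \<psi> r)"
    unfolding weighted_def using assms harnack[of r t] pos[of t]
    by (intro mult_mono) (auto simp: mult_left_mono less_imp_le)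
  then show ?thesis by (simp add: weighted_def mult_ac)
qed

lemma transform_integrable: assumes "0 \<le> z" shows "integrable \<mu> (\<lambda>y. exp (- z * y))"
proof (rule integrable_const_bound[where B="exp (z * M)"])
  show "AE y in \<mu>. norm (exp (- z * y)) \<le> exp (z * M)"
    using supp
  proof eventually_elim
    fix y assume "\<bar>y\<bar> \<le> M"
    then have "z * (- y) \<le> z * M" using assms by (intro mult_left_mono) auto
    then show "norm (exp (- z * y)) \<le> exp (z * M)" by simp
  qed
qed measurable

lemma transform_nonneg: "0 \<le> transform z" unfolding transform_def by (intro integral_nonneg_AE) auto

lemma transform_le: assumes "0 \<le> z" "z \<le> Z" shows "transform z \<le> exp (Z * M) * measure \<mu> (space \<mu>)"
proof -
  have "transform z \<le> (\<integral>y. exp (Z * M) \<partial>\<mu>)"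
    unfolding transform_def
  proof (rule integral_mono_AE[OF transform_integrable[OF assms(1)]])
    show "AE y in \<mu>. exp (- z * y) \<le> exp (Z * M)" using supp
    proof eventually_elim
      fix y assume "\<bar>y\<bar> \<le> M"
      then have "z * (- y) \<le> z * M" using assms by (intro mult_left_mono) auto
      also have "\<dots> \<le> Z * M" using assms M by (intro mult_right_mono) auto
      finally show "exp (- z * y) \<le> exp (Z * M)" by simp
    qed
  qed auto
  then show ?thesis by (simp add: mult.commute)
qed

text \<open>By Fubini and a shift, the weighted convolution integrates to \<open>exp (- z y)\<close>
  times the integral of \<open>weighted z\<close> over \<open>[- N - y, - y]\<close>, integrated in
  \<open>y\<close>. As \<open>\<bar>y\<bar> \<le> M\<close>, this window misses a piece of length at
  most \<open>M\<close> at one end of \<open>[- N, 0]\<close>; both possible losses are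
  subtracted.\<close>

lemma conv_lower:
  assumes z: "0 \<le> z" and N: "M \<le> N"
  defines "h \<equiv> \<lambda>t. exp (- z * t) * (\<integral>y. \<psi> (t - y) \<partial>\<mu>)"
  shows "h integrable_on {- N..0}"
    and "transform z * (mass z N - mass z M - integral {- N..- N + M} (weighted z)) \<le> integral {- N..0} h"
proof -
  interpret P: pair_sigma_finite lborel \<mu>
    by (intro pair_sigma_finite.intro sigma_finite_measure_axioms sigma_finite_lborel)
  define k where "k = (\<lambda>t y. indicator {- N..0} t * (exp (- z * t) * \<psi> (t - y)))"
  have [measurable]: "case_prod k \<in> borel_measurable (lborel \<Otimes>\<^sub>M \<mu>)"
    unfolding k_def by measurable
  have int: "integrable (lborel \<Otimes>\<^sub>M \<mu>) (case_prod k)"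
  proof (rule integrableI_bounded_set[where A="{- N..0} \<times> space \<mu>" and B="exp (z * N) * B"])
    show "emeasure (lborel \<Otimes>\<^sub>M \<mu>) ({- N..0} \<times> space \<mu>) < \<infinity>"
      by (subst emeasure_pair_measure_Times) (use N M in \<open>auto simp: emeasure_eq_measure ennreal_mult_less_top\<close>)
    show "AE x in lborel \<Otimes>\<^sub>M \<mu>. x \<in> {- N..0} \<times> space \<mu> \<longrightarrow> norm (case_prod k x) \<le> exp (z * N) * B"
    proof (intro AE_I2 impI)
      fix x assume "x \<in> {- N..0} \<times> space \<mu>"
      then obtain t y where x: "x = (t, y)" "- N \<le> t" "t \<le> 0" by auto
      have "z * (- t) \<le> z * N" using z x by (intro mult_left_mono) auto
      then show "norm (case_prod k x) \<le> exp (z * N) * B"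
        using x pos[of "t - y"] bound[of "t - y"] by (auto simp: k_def abs_mult intro!: mult_mono)
    qed
    show "AE x in lborel \<Otimes>\<^sub>M \<mu>. x \<notin> {- N..0} \<times> space \<mu> \<longrightarrow> case_prod k x = 0"
      by (intro AE_I2) (auto simp: k_def space_pair_measure split: split_indicator_asm)
  qed auto
  have hk: "(\<integral>y. k t y \<partial>\<mu>) = indicator {- N..0} t *\<^sub>R h t" for t
    by (simp add: k_def h_def)
  have "set_integrable lborel {- N..0} h"
    unfolding set_integrable_def using P.integrable_fst[OF int] by (simp add: hk)
  note hint = set_borel_integral_eq_integral[OF this]
  show "h integrable_on {- N..0}" by (rule hint(1))
  have inner: "(\<integral>t. k t y \<partial>lborel) = exp (- z * y) * integral {- N - y..- y} (weighted z)" for y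
  proof -
    have shift: "exp (- z * t) * \<psi> (t - y) = exp (- z * y) * weighted z (t + (- y))" for t
    proof -
      have e: "exp (- z * y) * exp (- z * (t + (- y))) = exp (- z * t)"
        by (simp add: mult_exp_exp algebra_simps)
      show ?thesis unfolding weighted_def mult.assoc[symmetric] e by simp
    qed
    have "(\<integral>t. k t y \<partial>lborel) = (LINT t:{- N..0}|lborel. exp (- z * t) * \<psi> (t - y))"
      by (simp add: k_def set_lebesgue_integral_def)
    also have "\<dots> = integral {- N..0} (\<lambda>t. exp (- z * t) * \<psi> (t - y))"
      by (intro set_borel_integral_eq_integral borel_integrable_atLeastAtMost')
        (auto intro!: continuous_intros continuous_on_compose2[OF psi_continuous[of UNIV]])
    also have "\<dots> = integral {- N..0} (\<lambda>t. exp (- z * y) * weighted z (t + (- y)))"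
      by (simp only: shift)
    also have "\<dots> = exp (- z * y) * integral {- N..0} (\<lambda>t. weighted z (t + (- y)))"
      by simp
    also have "integral {- N..0} (\<lambda>t. weighted z (t + (- y))) = integral {- N - y..- y} (weighted z)"
      using integral_shift[of "- N" "- y" 0 "weighted z"] weighted_continuous by (simp add: o_def)
    finally show ?thesis .
  qed
  have lower: "mass z N - mass z M - integral {- N..- N + M} (weighted z) \<le> integral {- N - y..- y} (weighted z)"
    if "\<bar>y\<bar> \<le> M" for y
  proof (cases "0 \<le> y")
    case True
    have "mass z N = integral {- N..- y} (weighted z) + integral {- y..0} (weighted z)"
      unfolding mass_def using True that N by (intro Henstock_Kurzweil_Integration.integral_combine[symmetric] weighted_int) auto
    moreover have "integral {- N..- y} (weighted z) \<le> integral {- N - y..- y} (weighted z)"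
      using True by (intro weighted_integral_mono) auto
    moreover have "integral {- y..0} (weighted z) \<le> mass z M"
      unfolding mass_def using that by (intro weighted_integral_mono) auto
    ultimately show ?thesis using weighted_integral_nonneg[of "- N" "- N + M" z] by simp
  next
    case False
    have "mass z N = integral {- N..- N - y} (weighted z) + integral {- N - y..0} (weighted z)"
      unfolding mass_def using False that N by (intro Henstock_Kurzweil_Integration.integral_combine[symmetric] weighted_int) auto
    moreover have "integral {- N - y..0} (weighted z) \<le> integral {- N - y..- y} (weighted z)"
      using False by (intro weighted_integral_mono) auto
    moreover have "integral {- N..- N - y} (weighted z) \<le> integral {- N..- N + M} (weighted z)"
      using that by (intro weighted_integral_mono) auto
    ultimately show ?thesis using weighted_integral_nonneg[of "- M" 0 z] by (simp add: mass_def)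
  qed
  have "transform z * (mass z N - mass z M - integral {- N..- N + M} (weighted z))
      = (\<integral>y. exp (- z * y) * (mass z N - mass z M - integral {- N..- N + M} (weighted z)) \<partial>\<mu>)"
    by (simp add: transform_def)
  also have "\<dots> \<le> (\<integral>y. (\<integral>t. k t y \<partial>lborel) \<partial>\<mu>)"
  proof (rule integral_mono_AE)
    show "integrable \<mu> (\<lambda>y. exp (- z * y) * (mass z N - mass z M - integral {- N..- N + M} (weighted z)))"
      using transform_integrable[OF z] by simp
    show "integrable \<mu> (\<lambda>y. \<integral>t. k t y \<partial>lborel)"
      using P.integrable_snd[OF int] .
    show "AE y in \<mu>. exp (- z * y) * (mass z N - mass z M - integral {- N..- N + M} (weighted z)) \<le> (\<integral>t. k t y \<partial>lborel)"
      using supp by eventually_elim (unfold inner, intro mult_left_mono lower, auto)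
  qed
  also have "\<dots> = (\<integral>t. (\<integral>y. k t y \<partial>\<mu>) \<partial>lborel)"
    by (rule P.Fubini_integral[OF int])
  also have "\<dots> = integral {- N..0} h"
    using hint(2) by (simp add: hk set_lebesgue_integral_def)
  finally show "transform z * (mass z N - mass z M - integral {- N..- N + M} (weighted z)) \<le> integral {- N..0} h" .
qed

section \<open>Integral inequality and bootstrapping of the decay exponent\<close>

definition boundary_const :: "real \<Rightarrow> real" where
  "boundary_const Z = \<Lambda> + Z + \<bar>c\<bar> + b * (exp (Z * M) * measure \<mu> (space \<mu>)) * (M * exp (\<Lambda> * M))"

text \<open>The supersolution inequality is integrated against \<open>exp (- z t)\<close> over
  \<open>[- N, 0]\<close>. The terms at \<open>- N\<close>, including the left loss in
  \<open>conv_lower\<close>, are bounded by multiples of \<open>weighted z (- N)\<close> through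
  \<open>deriv_le\<close> and Harnack, with one constant for all \<open>z \<le> Z\<close>.\<close>

lemma laplace_ineq:
  assumes z: "0 \<le> z" "z \<le> Z" and N: "M \<le> N"
  shows "(z\<^sup>2 - c * z - a + b * transform z) * mass z N \<le>
    b * transform z * mass z M - (p 0 + (z - c) * \<psi> 0) + boundary_const Z * weighted z (- N)"
proof -
  \<comment> \<open>A primitive of \<open>exp (- z t) (q - c p - z (z - c) \<psi>)\<close>; it does
    the integrations by parts at once.\<close>
  define F where "F = (\<lambda>t. exp (- z * t) * (p t + (z - c) * \<psi> t))"
  define h where "h = (\<lambda>t. exp (- z * t) * (\<integral>y. \<psi> (t - y) \<partial>\<mu>))"
  note hh = conv_lower[OF z(1) N, folded h_def]
  have N0: "0 \<le> N" using N M by simp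
  have F: "((\<lambda>t. exp (- z * t) * (q t - c * p t - z * (z - c) * \<psi> t)) has_integral F 0 - F (- N)) {- N..0}"
  proof (rule fundamental_theorem_of_calculus)
    fix t
    have "(F has_real_derivative exp (- z * t) * (q t - c * p t - z * (z - c) * \<psi> t)) (at t)"
      unfolding F_def by (auto intro!: derivative_eq_intros deriv1 deriv2 simp: algebra_simps)
    then show "(F has_vector_derivative exp (- z * t) * (q t - c * p t - z * (z - c) * \<psi> t)) (at t within {- N..0})"
      by (simp add: has_real_derivative_iff_has_vector_derivative has_vector_derivative_at_within)
  qed (use N0 in auto)
  have G: "((\<lambda>t. (a - z * (z - c)) * weighted z t - b * h t) has_integral
      (a - z * (z - c)) * mass z N - b * integral {- N..0} h) {- N..0}"
    unfolding mass_def
    by (intro has_integral_diff has_integral_mult_right integrable_integral weighted_int hh(1))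
  have "F 0 - F (- N) \<le> (a - z * (z - c)) * mass z N - b * integral {- N..0} h"
  proof (rule has_integral_le[OF F G])
    fix t assume t: "t \<in> {- N..0}"
    have "exp (- z * t) * (q t - c * p t - z * (z - c) * \<psi> t)
        \<le> exp (- z * t) * (a * \<psi> t - b * (\<integral>y. \<psi> (t - y) \<partial>\<mu>) - z * (z - c) * \<psi> t)"
      using super[of t] t by (intro mult_left_mono) auto
    also have "\<dots> = (a - z * (z - c)) * weighted z t - b * h t"
      by (simp add: weighted_def h_def algebra_simps)
    finally show "exp (- z * t) * (q t - c * p t - z * (z - c) * \<psi> t) \<le> (a - z * (z - c)) * weighted z t - b * h t" .
  qed
  moreover have "b * (transform z * (mass z N - mass z M - integral {- N..- N + M} (weighted z))) \<le> b * integral {- N..0} h"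
    using hh(2) b by (rule mult_left_mono)
  ultimately have 1: "(z\<^sup>2 - c * z - a + b * transform z) * mass z N \<le>
      b * transform z * mass z M - F 0 + F (- N) + b * transform z * integral {- N..- N + M} (weighted z)"
    by (simp add: algebra_simps power2_eq_square)
  have "integral {- N..- N + M} (weighted z) \<le> integral {- N..- N + M} (\<lambda>_. exp (\<Lambda> * M) * weighted z (- N))"
  proof (rule integral_le[OF weighted_int integrable_const_ivl])
    fix t assume t: "t \<in> {- N..- N + M}"
    have "weighted z t \<le> exp (\<Lambda> * (t - (- N))) * weighted z (- N)" using z t N by (intro weighted_harnack) auto
    also have "\<dots> \<le> exp (\<Lambda> * M) * weighted z (- N)"
      using t lam weighted_pos[of z "- N"] by (intro mult_right_mono) auto
    finally show "weighted z t \<le> exp (\<Lambda> * M) * weighted z (- N)" .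
  qed
  then have 2: "integral {- N..- N + M} (weighted z) \<le> M * exp (\<Lambda> * M) * weighted z (- N)"
    using M by (simp add: mult_ac)
  have 3: "b * transform z * integral {- N..- N + M} (weighted z)
      \<le> (b * (exp (Z * M) * measure \<mu> (space \<mu>))) * (M * exp (\<Lambda> * M) * weighted z (- N))"
    using b transform_le[OF z] transform_nonneg[of z]
    by (intro mult_mono[OF _ 2] mult_left_mono weighted_integral_nonneg) auto
  have "p (- N) + (z - c) * \<psi> (- N) \<le> (\<Lambda> + Z + \<bar>c\<bar>) * \<psi> (- N)"
  proof -
    have "(z - c) * \<psi> (- N) \<le> (Z + \<bar>c\<bar>) * \<psi> (- N)"
      using z pos[of "- N"] by (intro mult_right_mono) auto
    then show ?thesis using deriv_le[of "- N"] N0 by (simp add: algebra_simps)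
  qed
  then have 4: "F (- N) \<le> (\<Lambda> + Z + \<bar>c\<bar>) * weighted z (- N)"
    unfolding F_def weighted_def by (subst mult.left_commute, intro mult_left_mono) auto
  show ?thesis using 1 3 4 by (simp add: F_def boundary_const_def algebra_simps)
qed

text \<open>As \<open>weighted y (- N)\<close> is the derivative of \<open>mass y N\<close> in
  \<open>N\<close>, \<open>laplace_ineq\<close> is a differential inequality: once above
  \<open>C1 / \<kappa>\<close>, the mass grows at least like \<open>exp (\<rho> N)\<close>. The old
  bound allows only \<open>N exp (\<rho> N / 2)\<close>, so the mass is bounded, and Harnack makes
  this a pointwise bound.\<close>

lemma improve_rate:
  assumes kappa: "0 < \<kappa>" "\<And>z. 0 \<le> z \<Longrightarrow> z \<le> Z \<Longrightarrow> \<kappa> \<le> z\<^sup>2 - c * z - a + b * transform z"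
    and rho: "\<rho> = \<kappa> / C" "boundary_const Z \<le> C" "0 < C"
    and z: "0 \<le> z" "z + \<rho> / 2 \<le> Z"
    and A: "\<And>t. t \<le> 0 \<Longrightarrow> \<psi> t \<le> A * exp (z * t)"
  shows "\<exists>A'. \<forall>t\<le>0. \<psi> t \<le> A' * exp ((z + \<rho> / 2) * t)"
proof -
  \<comment> \<open>A gain of half of \<open>\<rho>\<close> keeps the growth allowed by the old
    bound strictly below the forced rate \<open>\<rho>\<close>.\<close>
  define y where "y = z + \<rho> / 2"
  have rho0: "0 < \<rho>" using kappa rho by simp
  have y: "0 \<le> y" "y \<le> Z" using z rho0 by (auto simp: y_def)
  define C1 where "C1 = b * transform y * mass y M - (p 0 + (y - c) * \<psi> 0)"
  define J where "J = (\<lambda>N. exp (- \<rho> * N) * (mass y N - C1 / \<kappa>))"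
  have step: "\<rho> * (mass y N - C1 / \<kappa>) \<le> weighted y (- N)" if "M \<le> N" for N
  proof -
    have "\<kappa> * mass y N \<le> (y\<^sup>2 - c * y - a + b * transform y) * mass y N"
      using kappa(2)[OF y] weighted_integral_nonneg[of "- N" 0 y] by (intro mult_right_mono) (auto simp: mass_def)
    also have "\<dots> \<le> C1 + boundary_const Z * weighted y (- N)"
      using laplace_ineq[OF y that] by (simp add: C1_def)
    also have "\<dots> \<le> C1 + C * weighted y (- N)"
      using rho(2) weighted_pos[of y "- N"] by (intro add_left_mono mult_right_mono) auto
    finally have "\<rho> * C * mass y N \<le> C1 + C * weighted y (- N)" using rho by simp
    moreover have "C * (\<rho> * (C1 / \<kappa>)) = C1" using rho kappa by simp
    ultimately have "C * (\<rho> * (mass y N - C1 / \<kappa>)) \<le> C * weighted y (- N)"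
      by (simp only: right_diff_distrib) (simp add: mult_ac)
    then show ?thesis using rho(3) by simp
  qed
  have dI: "(mass y has_real_derivative weighted y (- N)) (at N)" if "0 < N" for N
  proof -
    have mass_eq: "mass y = (\<lambda>N. integral {0..N} (\<lambda>t. weighted y (- t)))"
      using Henstock_Kurzweil_Integration.integral_reflect_real[where f="\<lambda>t. weighted y (- t)" and a=0] by (auto simp: mass_def fun_eq_iff)
    have "((\<lambda>N. integral {0..N} (\<lambda>t. weighted y (- t))) has_real_derivative weighted y (- N)) (at N within {0..N + 1})"
      using that by (intro integral_has_real_derivative)
        (auto intro!: continuous_on_compose2[OF weighted_continuous[of UNIV]] continuous_intros)
    then show ?thesis using that by (simp add: at_within_Icc_at mass_eq)
  qed
  have mono: "J N \<le> J N'" if "M < N" "N \<le> N'" for N N'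
  proof (rule DERIV_nonneg_imp_nondecreasing[OF that(2)])
    fix x assume x: "N \<le> x" "x \<le> N'"
    have "(J has_real_derivative exp (- \<rho> * x) * (weighted y (- x) - \<rho> * (mass y x - C1 / \<kappa>))) (at x)"
      unfolding J_def using that M x kappa(1)
      by (auto intro!: derivative_eq_intros dI simp: algebra_simps)
    then show "\<exists>d. (J has_real_derivative d) (at x) \<and> 0 \<le> d"
      using step[of x] x that by (intro exI conjI) auto
  qed
  have A0: "0 < A" using A[of 0] pos[of 0] by simp
  have mass_le: "mass y N \<le> N * (A * exp (\<rho> / 2 * N))" if "0 \<le> N" for N
  proof -
    have "mass y N \<le> integral {- N..0} (\<lambda>_. A * exp (\<rho> / 2 * N))"
      unfolding mass_def
    proof (rule integral_le[OF weighted_int integrable_const_ivl])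
      fix t assume t: "t \<in> {- N..0}"
      have e: "exp (- y * t) * exp (z * t) = exp (\<rho> / 2 * (- t))"
        by (simp add: mult_exp_exp y_def algebra_simps)
      have "weighted y t \<le> exp (- y * t) * (A * exp (z * t))"
        unfolding weighted_def using t by (intro mult_left_mono A) auto
      also have "\<dots> = A * exp (\<rho> / 2 * (- t))"
        unfolding e[symmetric] by (rule mult.left_commute)
      also have "\<dots> \<le> A * exp (\<rho> / 2 * N)"
        using t A0 rho0 mult_left_mono[of "- t" N \<rho>] by (intro mult_left_mono) auto
      finally show "weighted y t \<le> A * exp (\<rho> / 2 * N)" .
    qed
    then show ?thesis using that by (simp add: mult_ac)
  qed
  have bounded: "mass y N \<le> C1 / \<kappa>" if N: "M < N" for N
  proof -
    \<comment> \<open>\<open>U\<close> dominates the nondecreasing \<open>J\<close> and tends to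
      \<open>0\<close>, so \<open>J\<close> is never positive beyond \<open>M\<close>.\<close>
    define U where "U = (\<lambda>x. exp (- \<rho> * x) * (x * (A * exp (\<rho> / 2 * x)) - C1 / \<kappa>))"
    have "((\<lambda>x. A * (x / exp (\<rho> / 2 * x)) - exp (- \<rho> * x) * (C1 / \<kappa>)) \<longlongrightarrow> A * 0 - 0 * (C1 / \<kappa>)) at_top"
      using rho0 by (intro tendsto_intros) real_asymp+
    also have "(\<lambda>x. A * (x / exp (\<rho> / 2 * x)) - exp (- \<rho> * x) * (C1 / \<kappa>)) = U"
    proof
      fix x
      have "exp (- \<rho> * x) * exp (\<rho> / 2 * x) = inverse (exp (\<rho> / 2 * x))"
      proof -
        have "- \<rho> * x + \<rho> / 2 * x = - (\<rho> / 2 * x)" by simp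
        then show ?thesis by (metis exp_add exp_minus)
      qed
      moreover have "d * (x * (A * e) - k) = A * (x * (d * e)) - d * k" for d e k :: real
        by (simp add: algebra_simps)
      ultimately show "A * (x / exp (\<rho> / 2 * x)) - exp (- \<rho> * x) * (C1 / \<kappa>) = U x"
        by (simp only: U_def divide_inverse)
    qed
    finally have U: "(U \<longlongrightarrow> 0) at_top" by simp
    have "eventually (\<lambda>x. J N \<le> U x) at_top"
      using eventually_ge_at_top[of N]
    proof eventually_elim
      fix x assume x: "N \<le> x"
      have "J N \<le> J x" using mono[OF N x] .
      also have "\<dots> \<le> U x"
        unfolding J_def U_def using mass_le[of x] N x M by (intro mult_left_mono) auto
      finally show "J N \<le> U x" .
    qed
    then have "J N \<le> 0" by (rule tendsto_lowerbound[OF U]) simp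
    then show ?thesis by (simp add: J_def mult_le_0_iff)
  qed
  have "\<psi> t \<le> (exp \<Lambda> * (C1 / \<kappa>)) * exp (y * t)" if t: "t \<le> 0" for t
  proof -
    have "weighted y t = integral {t - 1..t} (\<lambda>_. weighted y t)" by simp
    also have "\<dots> \<le> integral {t - 1..t} (\<lambda>r. exp \<Lambda> * weighted y r)"
    proof (rule integral_le[OF integrable_const_ivl])
      show "(\<lambda>r. exp \<Lambda> * weighted y r) integrable_on {t - 1..t}"
        by (intro integrable_on_mult_right weighted_int)
      fix r assume r: "r \<in> {t - 1..t}"
      have "weighted y t \<le> exp (\<Lambda> * (t - r)) * weighted y r" using r t y by (intro weighted_harnack) auto
      also have "\<dots> \<le> exp (\<Lambda> * 1) * weighted y r"
        using r lam weighted_pos[of y r] by (intro mult_right_mono) (auto intro!: mult_left_le)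
      finally show "weighted y t \<le> exp \<Lambda> * weighted y r" by simp
    qed
    also have "\<dots> = exp \<Lambda> * integral {t - 1..t} (weighted y)" by simp
    \<comment> \<open>The maximum with \<open>M + 1\<close> meets the condition \<open>M < N\<close>
      of \<open>bounded\<close>.\<close>
    also have "\<dots> \<le> exp \<Lambda> * mass y (max (1 - t) (M + 1))"
      unfolding mass_def using t by (intro mult_left_mono weighted_integral_mono) auto
    also have "\<dots> \<le> exp \<Lambda> * (C1 / \<kappa>)"
      by (intro mult_left_mono bounded) auto
    finally have "weighted y t * exp (y * t) \<le> (exp \<Lambda> * (C1 / \<kappa>)) * exp (y * t)"
      by (rule mult_right_mono) simp
    moreover have "weighted y t * exp (y * t) = \<psi> t"
      by (simp add: weighted_def exp_minus)
    ultimately show ?thesis by simp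
  qed
  then show ?thesis unfolding y_def by blast
qed

text \<open>Since \<open>\<kappa>\<close> is uniform in \<open>z\<close>, each use of
  \<open>improve_rate\<close> gains the same \<open>\<rho> / 2\<close>. Starting from boundedness,
  the exponent passes \<open>\<Lambda>\<close>, against the lower bound from
  \<open>harnack\<close>.\<close>

lemma no_positive_characteristic:
  assumes kappa: "0 < \<kappa>" "\<And>z. 0 \<le> z \<Longrightarrow> z \<le> \<Lambda> + 1 \<Longrightarrow> \<kappa> \<le> z\<^sup>2 - c * z - a + b * transform z"
  shows False
proof -
  \<comment> \<open>The entries \<open>1\<close> and \<open>\<kappa>\<close> ensure
    \<open>0 < C\<close> and \<open>\<rho> \<le> 1\<close>.\<close>
  define C where "C = max (boundary_const (\<Lambda> + 1)) (max 1 \<kappa>)"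
  define \<rho> where "\<rho> = \<kappa> / C"
  have rho: "0 < \<rho>" "\<rho> \<le> 1" using kappa by (auto simp: \<rho>_def C_def field_simps)
  have rate: "\<exists>A. \<forall>t\<le>0. \<psi> t \<le> A * exp ((real k * (\<rho> / 2)) * t)" if "real k * (\<rho> / 2) \<le> \<Lambda> + 1" for k
    using that
  proof (induction k)
    case 0
    then show ?case using bound by auto
  next
    case (Suc k)
    have eq: "real (Suc k) * (\<rho> / 2) = real k * (\<rho> / 2) + \<rho> / 2" by (simp add: field_simps)
    have "real k * (\<rho> / 2) \<le> \<Lambda> + 1" using Suc.prems rho unfolding eq by linarith
    then obtain A where A: "\<And>t. t \<le> 0 \<Longrightarrow> \<psi> t \<le> A * exp ((real k * (\<rho> / 2)) * t)"
      using Suc.IH by blast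
    show ?case unfolding eq
      by (rule improve_rate[OF kappa \<rho>_def _ _ _ _ A])
        (use Suc.prems[unfolded eq] rho kappa in \<open>auto simp: C_def\<close>)
  qed
  \<comment> \<open>The first multiple of \<open>\<rho> / 2\<close> above \<open>\<Lambda>\<close>;
    as \<open>\<rho> \<le> 1\<close>, it does not leave the range up to \<open>\<Lambda> + 1\<close>
    where \<open>\<kappa>\<close> is a lower bound.\<close>
  define k where "k = nat \<lfloor>\<Lambda> / (\<rho> / 2)\<rfloor> + 1"
  have "\<Lambda> / (\<rho> / 2) < real k" "real k \<le> \<Lambda> / (\<rho> / 2) + 1"
  proof -
    have "0 \<le> \<Lambda> / (\<rho> / 2)" using lam rho by simp
    then have "real k = real_of_int \<lfloor>\<Lambda> / (\<rho> / 2)\<rfloor> + 1" by (simp add: k_def)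
    then show "\<Lambda> / (\<rho> / 2) < real k" "real k \<le> \<Lambda> / (\<rho> / 2) + 1" by linarith+
  qed
  then have k: "\<Lambda> < real k * (\<rho> / 2)" "real k * (\<rho> / 2) \<le> \<Lambda> + \<rho> / 2"
    using rho by (auto simp: field_simps)
  define y where "y = real k * (\<rho> / 2)"
  obtain A where A: "\<And>t. t \<le> 0 \<Longrightarrow> \<psi> t \<le> A * exp (y * t)"
    using rate[of k] k rho unfolding y_def by auto
  have "((\<lambda>t. A * exp ((y - \<Lambda>) * t)) \<longlongrightarrow> A * 0) at_bot"
    using k by (intro tendsto_intros) (unfold y_def[symmetric], real_asymp)
  moreover have "eventually (\<lambda>t. \<psi> 0 \<le> A * exp ((y - \<Lambda>) * t)) at_bot"
    using eventually_le_at_bot[of 0]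
  proof eventually_elim
    fix t :: real assume t: "t \<le> 0"
    have e: "exp (\<Lambda> * (0 - t)) * exp (y * t) = exp ((y - \<Lambda>) * t)"
      by (simp add: mult_exp_exp algebra_simps)
    have "\<psi> 0 \<le> exp (\<Lambda> * (0 - t)) * \<psi> t" using harnack[OF t] by simp
    also have "\<dots> \<le> exp (\<Lambda> * (0 - t)) * (A * exp (y * t))"
      using A[OF t] by (intro mult_left_mono) auto
    also have "\<dots> = A * exp ((y - \<Lambda>) * t)"
      unfolding e[symmetric] by (rule mult.left_commute)
    finally show "\<psi> 0 \<le> A * exp ((y - \<Lambda>) * t)" .
  qed
  ultimately have "\<psi> 0 \<le> A * 0" by (rule tendsto_lowerbound) simp
  then show False using pos[of 0] by simp
qed

end

subsection \<open>The characteristic function as a Laplace transform\<close>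

text \<open>A probability measure for a normalized kernel; \<open>ennreal\<close> cuts negative
  values of \<open>K\<close>, which then occur only on a null set, to \<open>0\<close>.\<close>

definition kernel_measure :: "(real \<times> real \<Rightarrow> real) \<Rightarrow> (real \<times> real) measure" where
  "kernel_measure K = density lebesgue (\<lambda>x. ennreal (indicator half_plane x *\<^sub>R K x))"

text \<open>The characteristic function uses \<open>p = z c\<close> and \<open>q = z\<close>.
  Independent parameters also cover limits where \<open>z\<close> tends to \<open>0\<close> and
  \<open>c\<close> to \<open>- \<infinity>\<close> while \<open>z c\<close> stays bounded.\<close>

definition kernel_laplace :: "(real \<times> real \<Rightarrow> real) \<Rightarrow> real \<Rightarrow> real \<Rightarrow> ennreal" where
  "kernel_laplace K p q = (\<integral>\<^sup>+x. ennreal (exp (- (p * fst x + q * snd x))) \<partial>kernel_measure K)"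

lemma sets_kernel_measure [simp, measurable_cong]: "sets (kernel_measure K) = sets lebesgue"
  by (simp add: kernel_measure_def)

lemma space_kernel_measure [simp]: "space (kernel_measure K) = UNIV"
  by (simp add: kernel_measure_def)

lemma continuous_kernel_measurable:
  fixes h :: "real \<times> real \<Rightarrow> real"
  assumes "continuous_on UNIV h"
  shows "h \<in> borel_measurable (kernel_measure K)"
proof -
  have "h \<in> borel_measurable lborel"
    using borel_measurable_continuous_onI[OF assms] by simp
  then have "h \<in> borel_measurable lebesgue" by (rule measurable_completion)
  then show ?thesis using measurable_cong_sets[OF sets_kernel_measure refl] by blast
qed

lemma chi0_laplace:
  assumes "normalized_kernel K"
  shows "chi0 f g K z c = ereal (z\<^sup>2 - c * z - half_line_deriv f 0) +
     ereal (half_line_deriv g 0) * enn2ereal (kernel_laplace K (z * c) z)"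
proof -
  have [measurable]: "(\<lambda>x. indicator half_plane x *\<^sub>R K x) \<in> borel_measurable lebesgue"
    using assms by (auto simp: normalized_kernel_def set_integrable_def)
  have [measurable]: "(\<lambda>x::real\<times>real. exp (- (z * c * fst x + z * snd x))) \<in> borel_measurable lebesgue"
    using continuous_kernel_measurable[of "\<lambda>x. exp (- (z * c * fst x + z * snd x))" K]
    by (simp add: continuous_intros measurable_cong_sets[OF sets_kernel_measure refl])
  have "kernel_laplace K (z * c) z =
      (\<integral>\<^sup>+x. ennreal (indicator half_plane x *\<^sub>R K x) * ennreal (exp (- (z * c * fst x + z * snd x))) \<partial>lebesgue)"
    unfolding kernel_laplace_def kernel_measure_def by (rule nn_integral_density; measurable)
  also have "\<dots> = (\<integral>\<^sup>+(s, w)\<in>half_plane. ennreal (K (s, w) * exp (- z * (c * s + w))) \<partial>lebesgue)"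
    by (intro nn_integral_cong)
      (auto simp: ennreal_mult'' algebra_simps split: split_indicator)
  finally show ?thesis by (simp add: chi0_def)
qed

lemma prob_space_kernel_measure:
  assumes "normalized_kernel K"
  shows "prob_space (kernel_measure K)"
proof
  note K = assms[unfolded normalized_kernel_def set_integrable_def set_lebesgue_integral_def]
  have "emeasure (kernel_measure K) UNIV = (\<integral>\<^sup>+x. ennreal (indicator half_plane x *\<^sub>R K x) \<partial>lebesgue)"
    using K unfolding kernel_measure_def by (subst emeasure_density) auto
  also have "\<dots> = ennreal (\<integral>x. indicator half_plane x *\<^sub>R K x \<partial>lebesgue)"
  proof (rule nn_integral_eq_integral)
    have "AE x in lebesgue. x \<in> half_plane \<longrightarrow> 0 \<le> K x" using K by blast
    then show "AE x in lebesgue. 0 \<le> indicator half_plane x *\<^sub>R K x"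
      by eventually_elim (auto split: split_indicator)
  qed (use K in blast)
  finally show "emeasure (kernel_measure K) (space (kernel_measure K)) = 1"
    using K by simp
qed

lemma kernel_measure_AE:
  assumes "normalized_kernel K"
  shows "AE x in kernel_measure K. 0 \<le> fst x"
proof -
  note K = assms[unfolded normalized_kernel_def set_integrable_def]
  show ?thesis
    unfolding kernel_measure_def using K
    by (subst AE_density) (auto simp: half_plane_def split: split_indicator)
qed

lemma kernel_measure_integral:
  assumes K: "normalized_kernel K" and h: "h \<in> borel_measurable lebesgue"
  shows "set_integrable lebesgue half_plane (\<lambda>x. K x * h x) \<longleftrightarrow> integrable (kernel_measure K) h"
    and "set_lebesgue_integral lebesgue half_plane (\<lambda>x. K x * h x) = (\<integral>x. h x \<partial>kernel_measure K)"
proof -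
  note K' = assms(1)[unfolded normalized_kernel_def set_integrable_def]
  have m: "(\<lambda>x. indicator half_plane x *\<^sub>R K x) \<in> borel_measurable lebesgue"
    using K' by auto
  have "AE x in lebesgue. x \<in> half_plane \<longrightarrow> 0 \<le> K x" using K' by blast
  then have ae: "AE x in lebesgue. 0 \<le> indicator half_plane x *\<^sub>R K x"
    by eventually_elim (auto split: split_indicator)
  show "set_integrable lebesgue half_plane (\<lambda>x. K x * h x) \<longleftrightarrow> integrable (kernel_measure K) h"
    unfolding kernel_measure_def set_integrable_def
    by (subst integrable_density[OF h m ae]) (simp add: mult.assoc)
  show "set_lebesgue_integral lebesgue half_plane (\<lambda>x. K x * h x) = (\<integral>x. h x \<partial>kernel_measure K)"
    unfolding kernel_measure_def set_lebesgue_integral_def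
    by (subst integral_density[OF h m ae]) (simp add: mult.assoc)
qed

text \<open>Fatou's lemma: upper bounds survive the limit without a dominating function, even if the
  limit exponent is on the edge of convergence.\<close>

lemma kernel_laplace_limit:
  assumes p: "p \<longlonglongrightarrow> p'" and q: "q \<longlonglongrightarrow> q'" and r: "r \<longlonglongrightarrow> r'"
    and A: "\<And>n. A n \<in> sets lebesgue" "\<And>x. eventually (\<lambda>n. x \<in> A n) sequentially"
    and le: "\<And>n. (\<integral>\<^sup>+x. ennreal (indicator (A n) x * exp (- (p n * fst x + q n * snd x))) \<partial>kernel_measure K)
      \<le> ennreal (r n)"
  shows "kernel_laplace K p' q' \<le> ennreal r'"
proof -
  define u where "u = (\<lambda>n x. ennreal (indicator (A n) x * exp (- (p n * fst x + q n * snd x))))"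
  have [measurable]: "(\<lambda>x::real\<times>real. exp (- (p n * fst x + q n * snd x))) \<in> borel_measurable (kernel_measure K)" for n
    by (intro continuous_kernel_measurable continuous_intros)
  have [measurable]: "A n \<in> sets (kernel_measure K)" for n using A by simp
  have meas: "u n \<in> borel_measurable (kernel_measure K)" for n
    unfolding u_def by measurable
  have lim: "liminf (\<lambda>n. u n x) = ennreal (exp (- (p' * fst x + q' * snd x)))" for x
  proof (rule lim_imp_Liminf)
    have "(\<lambda>n. ennreal (exp (- (p n * fst x + q n * snd x)))) \<longlonglongrightarrow> ennreal (exp (- (p' * fst x + q' * snd x)))"
      by (intro tendsto_ennrealI tendsto_intros p q)
    then show "(\<lambda>n. u n x) \<longlonglongrightarrow> ennreal (exp (- (p' * fst x + q' * snd x)))"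
      by (rule Lim_transform_eventually)
        (use A(2)[of x] in eventually_elim, simp add: u_def)
  qed simp
  have "kernel_laplace K p' q' = (\<integral>\<^sup>+x. liminf (\<lambda>n. u n x) \<partial>kernel_measure K)"
    by (simp add: kernel_laplace_def lim)
  also have "\<dots> \<le> liminf (\<lambda>n. \<integral>\<^sup>+x. u n x \<partial>kernel_measure K)"
    by (rule nn_integral_liminf[OF meas])
  also have "\<dots> \<le> liminf (\<lambda>n. ennreal (r n))"
    by (intro Liminf_mono always_eventually allI) (use le in \<open>simp add: u_def\<close>)
  also have "\<dots> = ennreal r'"
    by (intro lim_imp_Liminf tendsto_ennrealI r) simp
  finally show ?thesis .
qed

section \<open>Sign and zeros of the characteristic function\<close>

lemma kernel_laplace_pos:
  assumes "normalized_kernel K" shows "0 < kernel_laplace K p q"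
proof (rule ccontr)
  interpret prob_space "kernel_measure K" by (rule prob_space_kernel_measure[OF assms])
  have m: "(\<lambda>x::real\<times>real. exp (- (p * fst x + q * snd x))) \<in> borel_measurable (kernel_measure K)"
    by (intro continuous_kernel_measurable continuous_intros)
  assume "\<not> 0 < kernel_laplace K p q"
  then have "kernel_laplace K p q = 0" by simp
  then have "AE x in kernel_measure K. False"
    unfolding kernel_laplace_def using m by (subst (asm) nn_integral_0_iff_AE) auto
  then show False by simp
qed

text \<open>Solving for the integral avoids arithmetic with infinity. A negative right-hand side
  becomes \<open>0\<close> under \<open>ennreal\<close>; strict positivity of the transform keeps
  the equivalence true then.\<close>

lemma chi0_nonpos_iff:
  assumes K: "normalized_kernel K" and g: "0 < half_line_deriv g 0"
  shows "chi0 f g K z c \<le> 0 \<longleftrightarrow> kernel_laplace K (z * c) z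
    \<le> ennreal ((half_line_deriv f 0 + c * z - z\<^sup>2) / half_line_deriv g 0)"
proof (cases "kernel_laplace K (z * c) z")
  case (real r)
  have "0 < r" using kernel_laplace_pos[OF K, of "z * c" z] real by simp
  have "chi0 f g K z c \<le> 0 \<longleftrightarrow> z\<^sup>2 - c * z - half_line_deriv f 0 + half_line_deriv g 0 * r \<le> 0"
    using real by (simp add: chi0_laplace[OF K] zero_ereal_def)
  also have "\<dots> \<longleftrightarrow> r \<le> (half_line_deriv f 0 + c * z - z\<^sup>2) / half_line_deriv g 0"
    using g by (simp add: field_simps)
  finally show ?thesis using real \<open>0 < r\<close> by (auto simp: ennreal_le_iff2)
next
  case top
  then show ?thesis using g by (simp add: chi0_laplace[OF K] top_unique)
qed

text \<open>The value at \<open>0\<close> is \<open>g'(0) - f'(0) > 0\<close>, so the intermediate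
  value theorem on \<open>[0, z]\<close> gives a zero other than \<open>0\<close>.\<close>

lemma chi0_root_of_nonpos:
  assumes K: "normalized_kernel K" and g: "0 < half_line_deriv g 0"
    and fg: "half_line_deriv f 0 < half_line_deriv g 0"
    and z: "0 \<le> z" "chi0 f g K z c \<le> 0"
  shows "\<exists>z>0. chi0 f g K z c = 0"
proof -
  interpret prob_space "kernel_measure K" by (rule prob_space_kernel_measure[OF K])
  define e where "e = (\<lambda>t x. exp (- (t * c * fst x + t * snd x)) :: real)"
  have m [measurable]: "e t \<in> borel_measurable (kernel_measure K)" for t
    unfolding e_def by (intro continuous_kernel_measurable continuous_intros)
  have "(\<integral>\<^sup>+x. ennreal (e z x) \<partial>kernel_measure K) < \<infinity>"
    using z(2)[unfolded chi0_nonpos_iff[OF K g]]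
    by (auto simp: kernel_laplace_def e_def intro: order.strict_trans1)
  then have iz: "integrable (kernel_measure K) (e z)"
    by (intro integrableI_nonneg m) (auto simp: e_def)
  \<comment> \<open>For a fixed point, \<open>e t x\<close> is monotone in \<open>t\<close>, hence
    below the sum of its values at \<open>0\<close> and \<open>z\<close>. This gives integrability
    and, by dominated convergence, continuity.\<close>
  have dom: "norm (e t x) \<le> 1 + e z x" if "t \<in> {0..z}" for t x
  proof (cases "0 \<le> c * fst x + snd x")
    case True
    then have "0 \<le> t * (c * fst x + snd x)" using that by simp
    then have "e t x \<le> 1" by (simp add: e_def algebra_simps)
    then show ?thesis by (auto simp: e_def intro: add_increasing2)
  next
    case False
    then have "z * (c * fst x + snd x) \<le> t * (c * fst x + snd x)"
      using that by (intro mult_right_mono_neg) auto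
    then have "e t x \<le> e z x" by (simp add: e_def algebra_simps)
    moreover have "0 \<le> e t x" by (simp add: e_def)
    ultimately show ?thesis by simp
  qed
  have it: "integrable (kernel_measure K) (e t)" if "t \<in> {0..z}" for t
  proof (rule Bochner_Integration.integrable_bound[where f="\<lambda>x. 1 + e z x"])
    show "AE x in kernel_measure K. norm (e t x) \<le> norm (1 + e z x)"
    proof (intro AE_I2)
      show "norm (e t x) \<le> norm (1 + e z x)" for x
        using order_trans[OF dom[OF that, of x] abs_ge_self] by (simp only: real_norm_def)
    qed
  qed (use iz in simp_all)
  define h where "h = (\<lambda>t. t\<^sup>2 - c * t - half_line_deriv f 0
      + half_line_deriv g 0 * (\<integral>x. e t x \<partial>kernel_measure K))"
  have chi: "chi0 f g K t c = ereal (h t)" if "t \<in> {0..z}" for t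
  proof -
    have "kernel_laplace K (t * c) t = ennreal (\<integral>x. e t x \<partial>kernel_measure K)"
      unfolding kernel_laplace_def using nn_integral_eq_integral[OF it[OF that]]
      by (simp add: e_def)
    moreover have "0 \<le> (\<integral>x. e t x \<partial>kernel_measure K)"
      by (intro integral_nonneg_AE) (auto simp: e_def)
    ultimately show ?thesis by (simp add: chi0_laplace[OF K] h_def)
  qed
  have "continuous_on {0..z} (\<lambda>t. \<integral>x. e t x \<partial>kernel_measure K)"
  proof (rule continuous_on_sequentiallyI)
    fix u a assume u: "\<forall>n. u n \<in> {0..z}" "a \<in> {0..z}" "u \<longlonglongrightarrow> a"
    show "(\<lambda>n. \<integral>x. e (u n) x \<partial>kernel_measure K) \<longlonglongrightarrow> (\<integral>x. e a x \<partial>kernel_measure K)"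
    proof (rule integral_dominated_convergence[where w="\<lambda>x. 1 + e z x"])
      show "AE x in kernel_measure K. (\<lambda>n. e (u n) x) \<longlonglongrightarrow> e a x"
        unfolding e_def by (intro AE_I2 tendsto_intros u)
    qed (use iz u dom in auto)
  qed
  then have "continuous_on {0..z} h"
    unfolding h_def by (intro continuous_intros)
  moreover have "h z \<le> 0" using chi[of z] z by (simp add: zero_ereal_def)
  moreover have h0: "0 < h 0" using fg prob_space by (simp add: h_def e_def)
  ultimately obtain t where "0 \<le> t" "t \<le> z" "h t = 0"
    using IVT2'[of h z 0 0] z by auto
  then show ?thesis using h0 chi[of t] by (intro exI[of _ t]) (auto simp: less_le zero_ereal_def)
qed

text \<open>Compactness of the interval for \<open>z\<close> and Fatou's lemma turn approximate zeros of truncated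
  characteristic functions into a genuine one; \<open>z' = 0\<close> is excluded because \<open>f'(0) < g'(0)\<close>.\<close>

lemma chi0_root_of_limit:
  fixes R :: real
  assumes K: "normalized_kernel K" and g: "0 < half_line_deriv g 0"
    and fg: "half_line_deriv f 0 < half_line_deriv g 0"
    and z: "\<And>n. 0 \<le> z n" "\<And>n. z n \<le> R"
    and c: "c \<longlonglongrightarrow> c'" and a: "a \<longlonglongrightarrow> half_line_deriv f 0"
    and b: "b \<longlonglongrightarrow> half_line_deriv g 0" "\<And>n. 0 < b n" and d: "d \<longlonglongrightarrow> 0"
    and A: "\<And>n. A n \<in> sets lebesgue" "\<And>x. eventually (\<lambda>n. x \<in> A n) sequentially"
    and le: "\<And>n. (\<integral>\<^sup>+x. ennreal (indicator (A n) x * exp (- (z n * c n * fst x + z n * snd x))) \<partial>kernel_measure K)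
      \<le> ennreal (e n)"
    and chi: "\<And>n. (z n)\<^sup>2 - c n * z n - a n + b n * e n \<le> d n"
  shows "\<exists>z>0. chi0 f g K z c' = 0"
proof -
  have "\<exists>l\<in>{0..R}. \<exists>r. strict_mono r \<and> (z \<circ> r) \<longlonglongrightarrow> l"
    using z compact_imp_seq_compact[OF compact_Icc[of 0 R]] unfolding seq_compact_def by auto
  then obtain l r where l: "0 \<le> l" and r: "strict_mono r" and zl: "(z \<circ> r) \<longlonglongrightarrow> l"
    by auto
  note sub = LIMSEQ_subseq_LIMSEQ[OF _ r, unfolded o_def]
  note lim = zl[unfolded o_def] sub[OF c] sub[OF a] sub[OF b(1)] sub[OF d]
  have "kernel_laplace K (l * c') l
    \<le> ennreal ((0 + half_line_deriv f 0 + c' * l - l\<^sup>2) / half_line_deriv g 0)"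
  proof (rule kernel_laplace_limit[where A="\<lambda>n. A (r n)" and p="\<lambda>n. z (r n) * c (r n)" and q="\<lambda>n. z (r n)"
      and r="\<lambda>n. (d (r n) + a (r n) + c (r n) * z (r n) - (z (r n))\<^sup>2) / b (r n)"])
    show "(\<lambda>n. (d (r n) + a (r n) + c (r n) * z (r n) - (z (r n))\<^sup>2) / b (r n))
        \<longlonglongrightarrow> (0 + half_line_deriv f 0 + c' * l - l\<^sup>2) / half_line_deriv g 0"
      using g by (intro tendsto_intros lim) auto
    show "eventually (\<lambda>n. x \<in> A (r n)) sequentially" for x
      using eventually_subseq[OF r A(2)] .
    show "(\<integral>\<^sup>+x. ennreal (indicator (A (r n)) x * exp (- (z (r n) * c (r n) * fst x + z (r n) * snd x))) \<partial>kernel_measure K)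
      \<le> ennreal ((d (r n) + a (r n) + c (r n) * z (r n) - (z (r n))\<^sup>2) / b (r n))" for n
      using le[of "r n"] chi[of "r n"] b(2)[of "r n"]
      by (elim order_trans) (auto intro!: ennreal_leI simp: field_simps)
  qed (intro tendsto_intros lim A)+
  then have "chi0 f g K l c' \<le> 0" by (simp add: chi0_nonpos_iff[OF K g])
  then show ?thesis using chi0_root_of_nonpos[OF K g fg l] by blast
qed

section \<open>Existence of the minimal speed\<close>

lemma chi0_zero_bounds:
  assumes K: "normalized_kernel K" and g: "0 < half_line_deriv g 0" and "chi0 f g K z c = 0"
  obtains e where "0 < e" "kernel_laplace K (z * c) z = ennreal e"
    "z\<^sup>2 - c * z - half_line_deriv f 0 + half_line_deriv g 0 * e = 0"
proof (cases "kernel_laplace K (z * c) z")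
  case (real r)
  then have "0 < r" using kernel_laplace_pos[OF K, of "z * c" z] by simp
  then show ?thesis using that[of r] real assms(3) by (simp add: chi0_laplace[OF K] zero_ereal_def)
next
  case top
  then show ?thesis using assms by (simp add: chi0_laplace[OF K])
qed

text \<open>\<open>LEAST\<close> on the reals is meaningful only if a minimum exists; here the set
  of speeds is nonempty, bounded below and closed.\<close>

lemma chi0_minimal_speed:
  fixes f g K
  defines "S \<equiv> {c. \<exists>z>0. chi0 f g K z c = 0}"
  assumes K: "normalized_kernel K" and g: "0 < half_line_deriv g 0"
    and fg: "half_line_deriv f 0 < half_line_deriv g 0"
    and fin: "\<exists>z>0. chi0 f g K z 0 < \<infinity>"
  shows "Inf S \<in> S" and "\<And>c. c \<in> S \<Longrightarrow> Inf S \<le> c"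
proof -
  interpret prob_space "kernel_measure K" by (rule prob_space_kernel_measure[OF K])
  let ?f = "half_line_deriv f 0" and ?g = "half_line_deriv g 0"
  have "S \<noteq> {}"
  proof -
    obtain z where z: "0 < z" "chi0 f g K z 0 < \<infinity>" using fin by blast
    then obtain e where e: "kernel_laplace K 0 z = ennreal e" "0 \<le> e"
      using g by (cases "kernel_laplace K 0 z") (auto simp: chi0_laplace[OF K])
    \<comment> \<open>Raising \<open>c\<close> from \<open>0\<close> at fixed \<open>z\<close> does
      not increase the integral, as \<open>s \<ge> 0\<close>, while \<open>- c z\<close> becomes
      negative enough to make the characteristic function nonpositive.\<close>
    define c where "c = max 0 ((z\<^sup>2 - ?f + ?g * e) / z)"
    have "kernel_laplace K (z * c) z \<le> kernel_laplace K 0 z"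
      unfolding kernel_laplace_def using kernel_measure_AE[OF K]
      by (intro nn_integral_mono_AE, eventually_elim)
        (use z in \<open>auto intro!: ennreal_leI mult_nonneg_nonneg simp: c_def\<close>)
    also have "\<dots> \<le> ennreal ((?f + c * z - z\<^sup>2) / ?g)"
    proof -
      have "(z\<^sup>2 - ?f + ?g * e) / z * z \<le> c * z" using z by (intro mult_right_mono) (auto simp: c_def)
      then have "z\<^sup>2 - ?f + ?g * e \<le> c * z" using z by simp
      then have "e \<le> (?f + c * z - z\<^sup>2) / ?g" using g by (simp add: field_simps)
      then show ?thesis by (simp add: e ennreal_leI)
    qed
    finally have "chi0 f g K z c \<le> 0" by (simp add: chi0_nonpos_iff[OF K g])
    then show ?thesis using chi0_root_of_nonpos[OF K g fg, of z c] z by (auto simp: S_def)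
  qed
  moreover have bdd: "bdd_below S"
  proof (rule ccontr)
    assume "\<not> bdd_below S"
    then have *: "\<exists>c\<in>S. c \<le> - (real n + 1)" for n unfolding bdd_below_def by (meson linear)
    have "\<exists>c z e. c \<le> - (real n + 1) \<and> 0 < z \<and> 0 < e \<and>
        kernel_laplace K (z * c) z = ennreal e \<and> z\<^sup>2 - c * z - ?f + ?g * e = 0" for n
    proof -
      obtain c z where c: "c \<le> - (real n + 1)" and z: "0 < z" "chi0 f g K z c = 0"
        using *[of n] by (auto simp: S_def)
      obtain e where "0 < e" "kernel_laplace K (z * c) z = ennreal e"
          "z\<^sup>2 - c * z - ?f + ?g * e = 0"
        using chi0_zero_bounds[OF K g z(2)] .
      with c z show ?thesis by blast
    qed
    then obtain c z e where c: "\<And>n. c n \<le> - (real n + 1)" and z: "\<And>n. 0 < z n" and e: "\<And>n. 0 < e n"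
      and lap: "\<And>n. kernel_laplace K (z n * c n) (z n) = ennreal (e n)"
      and chi: "\<And>n. (z n)\<^sup>2 - c n * z n - ?f + ?g * e n = 0" by metis
    \<comment> \<open>As \<open>c\<close> tends to \<open>- \<infinity>\<close>, the zero equation
      keeps \<open>y\<close> in \<open>[0, f'(0)]\<close>, which forces \<open>z\<close> to
      \<open>0\<close>; the exponents \<open>(z c, z)\<close> subconverge to
      \<open>(- l, 0)\<close>.\<close>
    define y where "y = (\<lambda>n. - c n * z n)"
    have y: "y n \<in> {0..?f}" and zy: "(real n + 1) * z n \<le> y n" for n
    proof -
      show zy: "(real n + 1) * z n \<le> y n" unfolding y_def using c[of n] z[of n] by (intro mult_right_mono) auto
      have "0 < ?g * e n" using g e[of n] by (rule mult_pos_pos)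
      moreover have "0 \<le> (real n + 1) * z n" using z[of n] by simp
      moreover have "0 \<le> (z n)\<^sup>2" by simp
      ultimately have "0 \<le> y n" "y n \<le> ?f" using chi[of n] zy unfolding y_def by linarith+
      then show "y n \<in> {0..?f}" by simp
    qed
    have zlim: "z \<longlonglongrightarrow> 0"
    proof (rule tendsto_sandwich[OF _ _ tendsto_const])
      show "eventually (\<lambda>n. z n \<le> ?f / (real n + 1)) sequentially"
      proof (intro always_eventually allI)
        fix n
        have "(real n + 1) * z n \<le> ?f" using zy[of n] y[of n] by simp
        then show "z n \<le> ?f / (real n + 1)" by (simp add: pos_le_divide_eq mult.commute)
      qed
      have "(\<lambda>n. 1 / (real n + 1)) \<longlonglongrightarrow> 0" by real_asymp
      from tendsto_mult[OF tendsto_const[of ?f] this]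
      show "(\<lambda>n. ?f / (real n + 1)) \<longlonglongrightarrow> 0" by simp
    qed (use z in \<open>auto intro!: always_eventually less_imp_le\<close>)
    have "\<exists>l\<in>{0..?f}. \<exists>r. strict_mono r \<and> (y \<circ> r) \<longlonglongrightarrow> l"
      using y compact_imp_seq_compact[OF compact_Icc[of 0 ?f]] unfolding seq_compact_def by blast
    then obtain l r where l: "0 \<le> l" and r: "strict_mono r" and yl: "(\<lambda>n. y (r n)) \<longlonglongrightarrow> l"
      by (auto simp: o_def)
    note zr = LIMSEQ_subseq_LIMSEQ[OF zlim r, unfolded o_def]
    have "kernel_laplace K (- l) 0 \<le> ennreal ((?f - 0\<^sup>2 - l) / ?g)"
    proof (rule kernel_laplace_limit[where A="\<lambda>_. UNIV" and p="\<lambda>n. - y (r n)" and q="\<lambda>n. z (r n)"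
        and r="\<lambda>n. (?f - (z (r n))\<^sup>2 - y (r n)) / ?g"])
      show "(\<integral>\<^sup>+x. ennreal (indicator UNIV x * exp (- (- y (r n) * fst x + z (r n) * snd x))) \<partial>kernel_measure K)
          \<le> ennreal ((?f - (z (r n))\<^sup>2 - y (r n)) / ?g)" for n
      proof -
        have "e (r n) = (?f - (z (r n))\<^sup>2 - y (r n)) / ?g"
          using chi[of "r n"] g by (simp add: y_def field_simps)
        then show ?thesis using lap[of "r n"] by (simp add: kernel_laplace_def y_def mult_ac)
      qed
      show "(\<lambda>n. (?f - (z (r n))\<^sup>2 - y (r n)) / ?g) \<longlonglongrightarrow> (?f - 0\<^sup>2 - l) / ?g"
        using g by (intro tendsto_intros zr yl) simp
      show "(\<lambda>n. - y (r n)) \<longlonglongrightarrow> - l" by (intro tendsto_intros yl)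
    qed (use zr in simp_all)
    \<comment> \<open>The limit integrand \<open>exp (l s)\<close> is at least \<open>1\<close>,
      whereas the bound \<open>(f'(0) - l) / g'(0)\<close> is less than \<open>1\<close>.\<close>
    moreover have "1 \<le> kernel_laplace K (- l) 0"
    proof -
      have "1 = (\<integral>\<^sup>+x. 1 \<partial>kernel_measure K)" using emeasure_space_1 by simp
      also have "\<dots> \<le> kernel_laplace K (- l) 0"
        unfolding kernel_laplace_def using kernel_measure_AE[OF K]
        by (intro nn_integral_mono_AE, eventually_elim) (use l in simp)
      finally show ?thesis .
    qed
    ultimately have "1 \<le> ennreal ((?f - 0\<^sup>2 - l) / ?g)" by (rule order_trans[rotated])
    then have "1 \<le> (?f - l) / ?g" by simp
    then show False using g fg l by (simp add: field_simps)
  qed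
  moreover have "closed S"
    unfolding closed_sequential_limits
  proof (intro allI impI, elim conjE)
    fix c c' assume cS: "\<forall>n. c n \<in> S" and c: "c \<longlonglongrightarrow> c'"
    have "\<exists>z e. 0 < z \<and> 0 < e \<and>
        kernel_laplace K (z * c n) z = ennreal e \<and> z\<^sup>2 - c n * z - ?f + ?g * e = 0" for n
    proof -
      obtain z where z: "0 < z" "chi0 f g K z (c n) = 0"
        using cS by (auto simp: S_def)
      obtain e where "0 < e" "kernel_laplace K (z * c n) z = ennreal e"
          "z\<^sup>2 - c n * z - ?f + ?g * e = 0"
        using chi0_zero_bounds[OF K g z(2)] .
      with z show ?thesis by blast
    qed
    then obtain z e where z: "\<And>n. 0 < z n" and e: "\<And>n. 0 < e n"
      and lap: "\<And>n. kernel_laplace K (z n * c n) (z n) = ennreal (e n)"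
      and chi: "\<And>n. (z n)\<^sup>2 - c n * z n - ?f + ?g * e n = 0" by metis
    obtain Q where Q: "\<And>n. \<bar>c n\<bar> \<le> Q"
      using convergent_imp_Bseq[OF convergentI[OF c]] unfolding Bseq_def by auto
    have "\<exists>z>0. chi0 f g K z c' = 0"
    proof (rule chi0_root_of_limit[OF K g fg, where z=z and c=c and a="\<lambda>_. ?f" and b="\<lambda>_. ?g"
        and d="\<lambda>_. 0" and A="\<lambda>_. UNIV" and e=e and R="Q + \<bar>?f\<bar> + 1"])
      \<comment> \<open>Beyond this bound \<open>z\<^sup>2 - c z - f'(0)\<close> is positive for all
        \<open>\<bar>c\<bar> \<le> Q\<close>, so zeros stay in a compact interval.\<close>
      show "z n \<le> Q + \<bar>?f\<bar> + 1" for n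
      proof (rule ccontr)
        assume *: "\<not> ?thesis"
        have "0 \<le> Q" using Q[of n] by simp
        then have "(\<bar>?f\<bar> + 1) * 1 \<le> (\<bar>?f\<bar> + 1) * z n" using * by (intro mult_left_mono) auto
        moreover have "c n * z n \<le> Q * z n" using Q[of n] z[of n] by (intro mult_right_mono) auto
        moreover have "(Q + \<bar>?f\<bar> + 1) * z n \<le> z n * z n" using * z[of n] by (intro mult_right_mono) auto
        moreover have "0 < ?g * e n" using g e[of n] by (rule mult_pos_pos)
        ultimately show False using chi[of n] by (simp add: algebra_simps power2_eq_square)
      qed
      show "(\<integral>\<^sup>+x. ennreal (indicator UNIV x * exp (- (z n * c n * fst x + z n * snd x))) \<partial>kernel_measure K)
          \<le> ennreal (e n)" for n
        using lap[of n] by (simp add: kernel_laplace_def)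
    qed (use z c g chi in \<open>auto intro: less_imp_le\<close>)
    then show "c' \<in> S" by (simp add: S_def)
  qed
  ultimately show "Inf S \<in> S" by (rule closed_contains_Inf)
  show "Inf S \<le> c" if "c \<in> S" for c using that bdd by (rule cInf_lower)
qed

section \<open>Linear bounds for the nonlinearities near \<open>0\<close>\<close>

lemma half_line_deriv_quotient:
  assumes "h differentiable (at 0 within {0..})" "h 0 = 0"
  shows "((\<lambda>u. h u / u) \<longlongrightarrow> half_line_deriv h 0) (at 0 within {0..})"
proof -
  have "(h has_vector_derivative half_line_deriv h 0) (at 0 within {0..})"
    unfolding half_line_deriv_def using assms(1) by (rule vector_derivative_works[THEN iffD1])
  then have "(h has_real_derivative half_line_deriv h 0) (at 0 within {0..})"
    by (simp add: has_real_derivative_iff_has_vector_derivative)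
  then show ?thesis using assms(2) by (simp add: has_field_derivative_iff)
qed

lemma linear_bounds_near_0:
  assumes g: "H1 g" and f: "H2 f g" and a: "half_line_deriv f 0 < a" and b: "b < half_line_deriv g 0"
  obtains d where "0 < d" "0 < a" "\<And>u. 0 < u \<Longrightarrow> u \<le> d \<Longrightarrow> f u \<le> a * u" "\<And>u. 0 < u \<Longrightarrow> u \<le> d \<Longrightarrow> b * u \<le> g u"
proof -
  have "f differentiable (at 0 within {0..})" "f 0 = 0" "g differentiable (at 0 within {0..})" "g 0 = 0"
    using f g by (auto simp: H1_def H2_def differentiable_on_def)
  then have "eventually (\<lambda>u. f u / u < a) (at 0 within {0..})" "eventually (\<lambda>u. b < g u / u) (at 0 within {0..})"
    using order_tendstoD(2)[OF half_line_deriv_quotient a] order_tendstoD(1)[OF half_line_deriv_quotient b] by auto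
  then have "eventually (\<lambda>u. f u / u < a \<and> b < g u / u) (at 0 within {0..})"
    by (rule eventually_conj)
  then obtain d where d0: "0 < d"
    and "\<forall>u\<in>{0..}. u \<noteq> 0 \<and> dist u 0 < d \<longrightarrow> f u / u < a \<and> b < g u / u"
    unfolding eventually_at by blast
  then have d: "f u / u < a \<and> b < g u / u" if "0 < u" "u < d" for u
    using that by simp
  \<comment> \<open>Strict monotonicity makes \<open>f u / u\<close> positive at
    \<open>u = d / 2\<close>, whence \<open>0 < a\<close> even if \<open>f'(0) = 0\<close>.\<close>
  have "f 0 < f (d / 2)"
    using f d0 strict_mono_onD[of "{0..}" f 0 "d / 2"] by (simp add: H2_def)
  then have "0 < f (d / 2)" using \<open>f 0 = 0\<close> by simp
  then have "0 < f (d / 2) / (d / 2)" using d0 by simp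
  then have "0 < a" using d[of "d / 2"] d0 by linarith
  moreover have "f u \<le> a * u" "b * u \<le> g u" if "0 < u" "u \<le> d / 2" for u
  proof -
    have "f u / u < a" "b < g u / u" using d[of u] that d0 by auto
    then show "f u \<le> a * u" "b * u \<le> g u"
      using that(1) by (simp_all add: pos_divide_less_eq pos_less_divide_eq)
  qed
  ultimately show ?thesis using d0 by (intro that[of "d / 2"]) auto
qed

subsection \<open>Semi-wavefronts\<close>

text \<open>The profile equation sees \<open>(s, w)\<close> only through \<open>c s + w\<close>, so
  the cut-off kernel is pushed forward to the line. Mass may be lost.\<close>

definition truncated_law :: "(real \<times> real \<Rightarrow> real) \<Rightarrow> real \<Rightarrow> real \<Rightarrow> real measure" where
  "truncated_law K c M = distr
     (density (kernel_measure K) (\<lambda>x. ennreal (indicator {x. \<bar>c * fst x + snd x\<bar> \<le> M} x)))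
     borel (\<lambda>x. c * fst x + snd x)"

lemma strip_in_sets [measurable]: "{x::real\<times>real. \<bar>c * fst x + snd x\<bar> \<le> M} \<in> sets lebesgue"
proof -
  have "closed {x::real\<times>real. \<bar>c * fst x + snd x\<bar> \<le> M}"
    by (intro closed_Collect_le continuous_intros)
  then show ?thesis by (intro sets_completionI_sets) simp
qed

lemma phase_measurable [measurable]: "(\<lambda>x. c * fst x + snd x) \<in> borel_measurable (kernel_measure K)"
  by (intro continuous_kernel_measurable continuous_intros)

lemma sets_truncated_law [simp, measurable_cong]: "sets (truncated_law K c M) = sets borel"
  by (simp add: truncated_law_def)

lemma truncated_law_integral:
  fixes h :: "real \<Rightarrow> real"
  assumes h [measurable]: "h \<in> borel_measurable borel"
  shows "(\<integral>y. h y \<partial>truncated_law K c M) =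
    (\<integral>x. indicator {x. \<bar>c * fst x + snd x\<bar> \<le> M} x * h (c * fst x + snd x) \<partial>kernel_measure K)"
proof -
  have "(\<integral>y. h y \<partial>truncated_law K c M) = (\<integral>x. h (c * fst x + snd x)
      \<partial>density (kernel_measure K) (\<lambda>x. ennreal (indicator {x. \<bar>c * fst x + snd x\<bar> \<le> M} x)))"
    unfolding truncated_law_def by (intro integral_distr) measurable
  also have "\<dots> = (\<integral>x. indicator {x. \<bar>c * fst x + snd x\<bar> \<le> M} x * h (c * fst x + snd x) \<partial>kernel_measure K)"
    by (subst integral_density) auto
  finally show ?thesis .
qed

lemma truncated_law_AE: "AE y in truncated_law K c M. \<bar>y\<bar> \<le> M"
  unfolding truncated_law_def
  by (subst AE_distr_iff; (measurable)?) (subst AE_density; auto split: split_indicator_asm)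

lemma finite_measure_truncated_law:
  assumes "normalized_kernel K" shows "finite_measure (truncated_law K c M)"
proof -
  interpret prob_space "kernel_measure K" by (rule prob_space_kernel_measure[OF assms])
  have "finite_measure (density (kernel_measure K) (\<lambda>x. ennreal (indicator {x. \<bar>c * fst x + snd x\<bar> \<le> M} x)))"
  proof
    have "emeasure (density (kernel_measure K) (\<lambda>x. ennreal (indicator {x. \<bar>c * fst x + snd x\<bar> \<le> M} x))) UNIV
      = (\<integral>\<^sup>+x. ennreal (indicator {x. \<bar>c * fst x + snd x\<bar> \<le> M} x) \<partial>kernel_measure K)"
      by (subst emeasure_density) auto
    also have "\<dots> \<le> (\<integral>\<^sup>+x. 1 \<partial>kernel_measure K)"
      by (intro nn_integral_mono) (auto split: split_indicator)
    also have "\<dots> = 1" using emeasure_space_1 by simp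
    finally show "emeasure (density (kernel_measure K) (\<lambda>x. ennreal (indicator {x. \<bar>c * fst x + snd x\<bar> \<le> M} x)))
      (space (density (kernel_measure K) (\<lambda>x. ennreal (indicator {x. \<bar>c * fst x + snd x\<bar> \<le> M} x)))) \<noteq> \<infinity>"
      by (auto simp: top_unique)
  qed
  then show ?thesis
    unfolding truncated_law_def by (rule finite_measure.finite_measure_distr) measurable
qed

text \<open>The evolution equation at time \<open>0\<close> suffices: there the solution is
  \<open>\<phi>\<close>, its time derivative is \<open>c \<phi>'\<close>, and the delayed argument
  is \<open>t - (c s + w)\<close>.\<close>

lemma wave_profile_equation:
  assumes K: "normalized_kernel K" and g: "H1 g" and wave: "semi_wavefront f g K c \<phi>"
  shows "(\<phi> has_real_derivative deriv \<phi> t) (at t)"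
    and "(deriv \<phi> has_real_derivative deriv (deriv \<phi>) t) (at t)"
    and "integrable (kernel_measure K) (\<lambda>x. g (\<phi> (t - (c * fst x + snd x))))"
    and "deriv (deriv \<phi>) t - c * deriv \<phi> t
      = f (\<phi> t) - (\<integral>x. g (\<phi> (t - (c * fst x + snd x))) \<partial>kernel_measure K)"
proof -
  note w = wave[unfolded semi_wavefront_def solution_def]
  have sol: "(\<lambda>x. \<phi> (x + c * 0)) differentiable (at x)"
      "deriv (\<lambda>x. \<phi> (x + c * 0)) differentiable (at x)"
      "set_integrable lebesgue half_plane (\<lambda>(s, w). K (s, w) * g (\<phi> (x - w + c * (0 - s))))"
      "deriv (\<lambda>\<tau>. \<phi> (x + c * \<tau>)) 0 = deriv (deriv (\<lambda>x. \<phi> (x + c * 0))) x - f (\<phi> (x + c * 0))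
        + set_lebesgue_integral lebesgue half_plane (\<lambda>(s, w). K (s, w) * g (\<phi> (x - w + c * (0 - s))))" for x
    using w by blast+
  show d1: "(\<phi> has_real_derivative deriv \<phi> t) (at t)" for t
    using sol(1)[of t] by (simp add: DERIV_deriv_iff_real_differentiable)
  show d2: "(deriv \<phi> has_real_derivative deriv (deriv \<phi>) t) (at t)"
    using sol(2)[of t] by (simp add: DERIV_deriv_iff_real_differentiable)
  have dt: "deriv (\<lambda>\<tau>. \<phi> (t + c * \<tau>)) 0 = c * deriv \<phi> t"
  proof (rule DERIV_imp_deriv)
    have "(\<phi> has_real_derivative deriv \<phi> t) (at (t + c * 0))" using d1[of t] by simp
    moreover have "((\<lambda>\<tau>. t + c * \<tau>) has_real_derivative c) (at 0)"
      by (auto intro!: derivative_eq_intros)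
    ultimately have "((\<lambda>\<tau>. \<phi> (t + c * \<tau>)) has_real_derivative deriv \<phi> t * c) (at 0)"
      by (rule DERIV_chain2)
    then show "((\<lambda>\<tau>. \<phi> (t + c * \<tau>)) has_real_derivative c * deriv \<phi> t) (at 0)"
      by (simp only: mult.commute)
  qed
  have "continuous_on UNIV (\<lambda>x. g (\<phi> (t - (c * fst x + snd x))))"
  proof (rule continuous_on_compose2[of UNIV "\<lambda>t. g (\<phi> t)" UNIV "\<lambda>x. t - (c * fst x + snd x)"])
    show "continuous_on UNIV (\<lambda>t. g (\<phi> t))"
      using g w by (intro continuous_on_compose2[of "{0..}" g UNIV \<phi>]) (auto simp: H1_def less_imp_le)
    show "continuous_on UNIV (\<lambda>x::real\<times>real. t - (c * fst x + snd x))"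
      by (intro continuous_intros)
  qed simp
  from continuous_kernel_measurable[OF this]
  have m: "(\<lambda>x. g (\<phi> (t - (c * fst x + snd x)))) \<in> borel_measurable lebesgue"
    using measurable_cong_sets[OF sets_kernel_measure refl] by blast
  have eq: "(\<lambda>(s, w). K (s, w) * g (\<phi> (t - w + c * (0 - s)))) = (\<lambda>x. K x * g (\<phi> (t - (c * fst x + snd x))))"
    by (auto simp: fun_eq_iff algebra_simps)
  show "integrable (kernel_measure K) (\<lambda>x. g (\<phi> (t - (c * fst x + snd x))))"
    using sol(3)[of t] unfolding eq kernel_measure_integral(1)[OF K m] .
  show "deriv (deriv \<phi>) t - c * deriv \<phi> t
      = f (\<phi> t) - (\<integral>x. g (\<phi> (t - (c * fst x + snd x))) \<partial>kernel_measure K)"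
    using sol(4)[of t] unfolding eq kernel_measure_integral(2)[OF K m] dt by simp
qed

text \<open>One index \<open>n\<close> controls the cut-off radius, the perturbed slopes and the
  margin \<open>1 / (n + 1)\<close>. If the margin failed for every \<open>n\<close>,
  \<open>chi0_root_of_limit\<close> would give a zero; so some \<open>n\<close> works, and a
  translate of \<open>\<phi>\<close> is an impossible supersolution.\<close>

lemma semi_wavefront_imp_root:
  assumes K: "normalized_kernel K" and g: "H1 g" and f: "H2 f g"
    and wave: "semi_wavefront f g K c \<phi>"
  shows "\<exists>z>0. chi0 f g K z c = 0"
proof (rule ccontr)
  assume no_root: "\<not> ?thesis"
  interpret prob_space "kernel_measure K" by (rule prob_space_kernel_measure[OF K])
  let ?f = "half_line_deriv f 0" and ?g = "half_line_deriv g 0"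
  have g0: "0 < ?g" and fg: "?f < ?g" using g f by (auto simp: H1_def H2_def)
  define a where "a = (\<lambda>n::nat. ?f + 1 / (real n + 1))"
  \<comment> \<open>The shift by \<open>2\<close> keeps \<open>b 0\<close> positive.\<close>
  define b where "b = (\<lambda>n::nat. ?g - ?g / (real n + 2))"
  have a_gt: "?f < a n" and a_le: "a n \<le> ?f + 1" and b_lt: "b n < ?g" and b_pos: "0 < b n" for n
  proof -
    show "?f < a n" "a n \<le> ?f + 1" "b n < ?g" using g0 by (simp_all add: a_def b_def)
    have "?g * 1 < ?g * (real n + 2)" using g0 by (intro mult_strict_left_mono) auto
    then show "0 < b n" by (simp add: b_def pos_divide_less_eq)
  qed
  define \<Lambda> where "\<Lambda> = (\<lambda>a. (c + sqrt (c\<^sup>2 + 4 * a)) / 2)"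
  define W where "W = (\<lambda>n z. \<integral>y. exp (- z * y) \<partial>truncated_law K c (real n))"
  \<comment> \<open>Fixed before \<open>n\<close>: as \<open>a n \<le> f'(0) + 1\<close> and
    \<open>\<Lambda>\<close> is monotone, it bounds every
    \<open>\<Lambda> (a n) + 1\<close>.\<close>
  define R where "R = \<Lambda> (?f + 1) + 1"
  have "\<exists>n. \<forall>z. 0 \<le> z \<longrightarrow> z \<le> R \<longrightarrow> 1 / (real n + 1) \<le> z\<^sup>2 - c * z - a n + b n * W n z"
  proof (rule ccontr)
    assume "\<not> ?thesis"
    then obtain z where z: "\<And>n. 0 \<le> z n" "\<And>n. z n \<le> R"
      and chi: "\<And>n. (z n)\<^sup>2 - c * z n - a n + b n * W n (z n) < 1 / (real n + 1)"
      unfolding not_ex not_all not_imp not_le by metis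
    have "\<exists>z>0. chi0 f g K z c = 0"
    proof (rule chi0_root_of_limit[OF K g0 fg z, where c="\<lambda>_. c" and a=a and b=b and d="\<lambda>n. 1 / (real n + 1)"
        and A="\<lambda>n. {x. \<bar>c * fst x + snd x\<bar> \<le> real n}" and e="\<lambda>n. W n (z n)"])
      show lim: "(\<lambda>n. 1 / (real n + 1)) \<longlonglongrightarrow> 0" by real_asymp
      show "a \<longlonglongrightarrow> ?f" unfolding a_def using tendsto_add[OF tendsto_const[of ?f] lim] by simp
      have "(\<lambda>n. 1 / (real n + 2)) \<longlonglongrightarrow> 0" by real_asymp
      from tendsto_diff[OF tendsto_const[of ?g] tendsto_mult[OF tendsto_const[of ?g] this]]
      show "b \<longlonglongrightarrow> ?g" unfolding b_def by simp
      show "eventually (\<lambda>n. x \<in> {x. \<bar>c * fst x + snd x\<bar> \<le> real n}) sequentially" for x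
        using eventually_ge_at_top[of "nat \<lceil>\<bar>c * fst x + snd x\<bar>\<rceil>"]
        by eventually_elim (simp add: nat_le_iff ceiling_le_iff)
      fix n
      define u where "u = (\<lambda>x. indicator {x. \<bar>c * fst x + snd x\<bar> \<le> real n} x * exp (- (z n * c * fst x + z n * snd x)))"
      have u_alt: "u x = indicator {x. \<bar>c * fst x + snd x\<bar> \<le> real n} x * exp (- z n * (c * fst x + snd x))" for x
        by (simp add: u_def algebra_simps)
      have [measurable]: "u \<in> borel_measurable (kernel_measure K)"
        unfolding u_alt[abs_def] by measurable
      have "integrable (kernel_measure K) u"
      proof (rule integrable_const_bound[where B="exp (z n * real n)"])
        have "norm (u x) \<le> exp (z n * real n)" for x
        proof (cases "\<bar>c * fst x + snd x\<bar> \<le> real n")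
          case True
          then have "z n * (- (c * fst x + snd x)) \<le> z n * real n" using z by (intro mult_left_mono) auto
          then have "- (z n * (c * fst x + snd x)) \<le> z n * real n" by (simp only: mult_minus_right)
          then show ?thesis using True by (simp add: u_alt)
        qed (simp add: u_alt)
        then show "AE x in kernel_measure K. norm (u x) \<le> exp (z n * real n)" by simp
      qed measurable
      then have "(\<integral>\<^sup>+x. ennreal (u x) \<partial>kernel_measure K) = ennreal (\<integral>x. u x \<partial>kernel_measure K)"
        by (intro nn_integral_eq_integral) (auto simp: u_def)
      also have "(\<integral>x. u x \<partial>kernel_measure K) = W n (z n)"
        unfolding W_def u_alt by (subst truncated_law_integral) auto
      finally show "(\<integral>\<^sup>+x. ennreal (indicator {x. \<bar>c * fst x + snd x\<bar> \<le> real n} x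
          * exp (- (z n * c * fst x + z n * snd x))) \<partial>kernel_measure K) \<le> ennreal (W n (z n))"
        by (simp add: u_def)
    qed (use chi b_pos in \<open>auto intro: less_imp_le\<close>)
    with no_root show False by blast
  qed
  then obtain n where chi: "\<And>z. 0 \<le> z \<Longrightarrow> z \<le> R \<Longrightarrow> 1 / (real n + 1) \<le> z\<^sup>2 - c * z - a n + b n * W n z"
    by blast
  obtain d where d: "0 < d" and a0: "0 < a n" and fd: "\<And>u. 0 < u \<Longrightarrow> u \<le> d \<Longrightarrow> f u \<le> a n * u"
    and gd: "\<And>u. 0 < u \<Longrightarrow> u \<le> d \<Longrightarrow> b n * u \<le> g u"
    using linear_bounds_near_0[OF g f a_gt[of n] b_lt[of n]] by metis
  note w = wave[unfolded semi_wavefront_def]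
  have pos: "0 < \<phi> t" for t using w by blast
  have "eventually (\<lambda>t. \<phi> t < d) at_bot"
    using w d by (blast intro: order_tendstoD(2))
  then obtain T0 where T0: "\<And>t. t \<le> T0 \<Longrightarrow> \<phi> t < d" unfolding eventually_at_bot_linorder by blast
  obtain B where B: "\<And>t. \<phi> t \<le> B"
    using w unfolding bounded_iff by (metis UNIV_I image_eqI abs_le_D1 real_norm_def)
  \<comment> \<open>For \<open>t \<le> 0\<close> and \<open>\<bar>y\<bar> \<le> n\<close> the
    arguments \<open>t - y + T\<close> are at most \<open>T0\<close>, where
    \<open>\<phi> < d\<close> and the linear bounds hold.\<close>
  define T where "T = T0 - real n"
  note prof = wave_profile_equation[OF K g wave]
  have lam: "0 < \<Lambda> (a n)" "(\<Lambda> (a n))\<^sup>2 - c * \<Lambda> (a n) = a n"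
  proof -
    have "sqrt (c\<^sup>2) < sqrt (c\<^sup>2 + 4 * a n)" using a0 by (subst real_sqrt_less_iff) simp
    then show "0 < \<Lambda> (a n)" by (simp add: \<Lambda>_def)
    have "(sqrt (c\<^sup>2 + 4 * a n))\<^sup>2 = c\<^sup>2 + 4 * a n" using a0 by (intro real_sqrt_pow2) simp
    then show "(\<Lambda> (a n))\<^sup>2 - c * \<Lambda> (a n) = a n"
      by (simp add: \<Lambda>_def power2_eq_square field_simps)
  qed
  interpret L: finite_measure "truncated_law K c (real n)"
    by (rule finite_measure_truncated_law[OF K])
  interpret linear_supersolution "truncated_law K c (real n)" "\<lambda>t. \<phi> (t + T)" "\<lambda>t. deriv \<phi> (t + T)"
    "\<lambda>t. deriv (deriv \<phi>) (t + T)" "a n" "b n" c "real n" "\<Lambda> (a n)" B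
  proof unfold_locales
    show "AE y in truncated_law K c (real n). \<bar>y\<bar> \<le> real n" by (rule truncated_law_AE)
    show "((\<lambda>t. \<phi> (t + T)) has_real_derivative deriv \<phi> (t + T)) (at t)" for t
      using prof(1)[of "t + T"] by (simp add: DERIV_shift)
    show "((\<lambda>t. deriv \<phi> (t + T)) has_real_derivative deriv (deriv \<phi>) (t + T)) (at t)" for t
      using prof(2)[of "t + T"] by (simp add: DERIV_shift)
    fix t :: real assume t: "t \<le> 0"
    have "continuous_on UNIV \<phi>" using w by blast
    then have [measurable]: "\<phi> \<in> borel_measurable borel" by (rule borel_measurable_continuous_onI)
    define u where "u = (\<lambda>x. indicator {x. \<bar>c * fst x + snd x\<bar> \<le> real n} x * \<phi> (t - (c * fst x + snd x) + T))"
    have [measurable]: "u \<in> borel_measurable (kernel_measure K)" unfolding u_def by measurable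
    have "integrable (kernel_measure K) u"
    proof (rule integrable_const_bound[where B=B])
      have "norm (u x) \<le> B" for x
        using B[of "t - (c * fst x + snd x) + T"] pos[of "t - (c * fst x + snd x) + T"]
        by (auto simp: u_def split: split_indicator)
      then show "AE x in kernel_measure K. norm (u x) \<le> B" by simp
    qed measurable
    \<comment> \<open>Inside the strip the linear bound for \<open>g\<close> applies; outside it
      \<open>u\<close> vanishes and \<open>g\<close> is nonnegative.\<close>
    then have "(\<integral>x. b n * u x \<partial>kernel_measure K) \<le> (\<integral>x. g (\<phi> (t + T - (c * fst x + snd x))) \<partial>kernel_measure K)"
    proof (intro integral_mono integrable_mult_right prof(3))
      fix x
      show "b n * u x \<le> g (\<phi> (t + T - (c * fst x + snd x)))"
      proof (cases "\<bar>c * fst x + snd x\<bar> \<le> real n")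
        case True
        then have "\<phi> (t + T - (c * fst x + snd x)) < d" using t by (intro T0) (auto simp: T_def)
        then show ?thesis using True gd[OF pos, of "t + T - (c * fst x + snd x)"]
          by (simp add: u_def algebra_simps)
      next
        case False
        then show ?thesis using g pos by (auto simp: u_def H1_def less_imp_le)
      qed
    qed auto
    moreover have "(\<integral>x. u x \<partial>kernel_measure K) = (\<integral>y. \<phi> (t - y + T) \<partial>truncated_law K c (real n))"
      unfolding u_def by (subst truncated_law_integral) auto
    moreover have "f (\<phi> (t + T)) \<le> a n * \<phi> (t + T)"
      using t by (intro fd pos less_imp_le[OF T0]) (auto simp: T_def)
    ultimately show "deriv (deriv \<phi>) (t + T) - c * deriv \<phi> (t + T)
        \<le> a n * \<phi> (t + T) - b n * (\<integral>y. \<phi> (t - y + T) \<partial>truncated_law K c (real n))"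
      using prof(4)[of "t + T"] by simp
  qed (use pos B a0 b_pos[of n] lam in \<open>auto intro: less_imp_le\<close>)
  have "\<Lambda> (a n) + 1 \<le> R" using a_le[of n] by (simp add: R_def \<Lambda>_def)
  then show False
    using no_positive_characteristic[of "1 / (real n + 1)"] chi by (simp add: W_def transform_def)
qed

theorem theorem1p2:
  fixes f g :: "real \<Rightarrow> real" and K :: "real \<times> real \<Rightarrow> real" and L :: real
  assumes "normalized_kernel K" and "H1 g" and "H2 f g" and "H3 f g"
    and "\<And>c. \<exists>\<gamma>::ereal. 0 < \<gamma> \<and>
           (\<forall>z\<ge>0. ereal z < \<gamma> \<longrightarrow> chi0 f g K z c < \<infinity>) \<and>
           (\<forall>z. \<gamma> < ereal z \<longrightarrow> chi0 f g K z c = \<infinity>)"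
    and "L > 0" and "\<And>s1 s2. s1 \<ge> 0 \<Longrightarrow> s2 \<ge> 0 \<Longrightarrow> \<bar>g s1 - g s2\<bar> \<le> L * \<bar>s1 - s2\<bar>"
  shows "\<forall>c < c_star f g K. \<not> (\<exists>\<phi>. semi_wavefront f g K c \<phi>)"
proof (intro allI impI notI, elim exE)
  fix c \<phi> assume c: "c < c_star f g K" and wave: "semi_wavefront f g K c \<phi>"
  have root: "\<exists>z>0. chi0 f g K z c = 0"
    using assms(1-3) wave by (rule semi_wavefront_imp_root)
  \<comment> \<open>Convergence at speed \<open>0\<close> for some positive \<open>z\<close> starts
    the existence proof for the minimal speed; \<open>c\<close> is then an admissible speed below
    the minimum.\<close>
  obtain \<gamma> :: ereal where \<gamma>: "0 < \<gamma>" "\<And>z. 0 \<le> z \<Longrightarrow> ereal z < \<gamma> \<Longrightarrow> chi0 f g K z 0 < \<infinity>"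
    using assms(5)[of 0] by blast
  obtain z where "0 < ereal z" "ereal z < \<gamma>" using ereal_dense2[OF \<gamma>(1)] by blast
  then have fin: "\<exists>z>0. chi0 f g K z 0 < \<infinity>" using \<gamma>(2)[of z] by auto
  have "0 < half_line_deriv g 0" "half_line_deriv f 0 < half_line_deriv g 0"
    using assms(2,3) by (auto simp: H1_def H2_def)
  note min = chi0_minimal_speed[OF assms(1) this fin]
  have "c_star f g K = Inf {c. \<exists>z>0. chi0 f g K z c = 0}"
    unfolding c_star_def using min by (intro Least_equality) auto
  then show False using min(2)[of c] root c by simp
qed

end
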